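(* In the adjacency-list model augmented with $\texttt{JUMP}$, the single-node problem can be solved with average-case (over targets) expected running time $\tilde O(\sqrt m)$.
   Context: Let $G=(V,E)$ be a directed graph with $n=|V|$ nodes and $m=|E|$ edges. Fix a constant $\alpha\in(0,1)$. An $\alpha$-discounted random walk from $s$: at each step, with probability $\alpha$ it terminates at the current node, otherwise it moves to a uniformly random out-neighbor of the current node. $\pi(s,t)$ is the probability that such a walk from $s$ terminates at $t$, and $\pi(t)=\frac1n\sum_{s\in V}\pi(s,t)$. Adjacency-list model: an algorithm accesses $G$ only through constant-time queries $\texttt{DEG-IN}(u)$, $\texttt{DEG-OUT}(u)$ (in-/out-degree of $u$), $\texttt{IN}(u,i)$, $\texttt{OUT}(u,i)$ ($i$-th in-/out-neighbor of $u$); additionally $\texttt{JUMP}()$ returns a uniformly random node of $V$. Single-node problem: given $G$ (via queries) and a target $t\in V$, output $\hat\pi(t)$ with $\Pr\{|\hat\pi(t)-\pi(t)|\ge\varepsilon\pi(t)\}\le p_f$, where $\varepsilon,p_f$ are fixed small constants. Average-case time: maximum over graphs with $n$ nodes and $m$ edges of $\frac1n\sum_{t\in V}$ (expected running time with target $t$). $\tilde O$ suppresses polylogarithmic factors in $n$. *)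

theory Defs
  imports "HOL-Probability.Probability"
begin

section \<open>Iterated probability kernels\<close>

primrec iterate_pmf :: "('a \<Rightarrow> 'a pmf) \<Rightarrow> nat \<Rightarrow> 'a \<Rightarrow> 'a pmf" where
  "iterate_pmf K 0 x = return_pmf x"
| "iterate_pmf K (Suc k) x = bind_pmf (K x) (iterate_pmf K k)"

text \<open>
  Only used for sets \<open>A\<close> of states that the kernel \<open>K\<close> fixes. For these the probabilities
  increase with \<open>k\<close>, and the supremum is the probability that the chain ever enters \<open>A\<close>.
\<close>

definition absorption_prob :: "('a \<Rightarrow> 'a pmf) \<Rightarrow> 'a \<Rightarrow> 'a set \<Rightarrow> real" where
  "absorption_prob K x A = (SUP k. measure_pmf.prob (iterate_pmf K k x) A)"


section \<open>Directed graphs given by adjacency lists\<close>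

text \<open>
  Nodes carry arbitrary natural numbers as identifiers, and the two lists of a node enumerate
  its neighbours in an arbitrary order.
\<close>

record adj_graph =
  verts :: "nat set"
  edges :: "(nat \<times> nat) set"
  in_list :: "nat \<Rightarrow> nat list"
  out_list :: "nat \<Rightarrow> nat list"

definition wf_graph :: "adj_graph \<Rightarrow> bool" where
  "wf_graph g \<longleftrightarrow>
     finite (verts g) \<and> verts g \<noteq> {} \<and> edges g \<subseteq> verts g \<times> verts g \<and>
     (\<forall>u. distinct (out_list g u) \<and> set (out_list g u) = {v. (u, v) \<in> edges g}) \<and>
     (\<forall>u. distinct (in_list g u) \<and> set (in_list g u) = {v. (v, u) \<in> edges g})"

definition graphs :: "nat \<Rightarrow> nat \<Rightarrow> adj_graph set" where
  "graphs n m = {g. wf_graph g \<and> card (verts g) = n \<and> card (edges g) = m}"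


section \<open>Discounted random walks and PageRank\<close>

text \<open>
  The state of a walk is its current node together with a flag telling whether it has
  terminated. A walk that does not stop at a node without out-neighbours cannot move; by
  convention it terminates there as well.
\<close>

definition walk_step :: "adj_graph \<Rightarrow> real \<Rightarrow> nat \<times> bool \<Rightarrow> (nat \<times> bool) pmf" where
  "walk_step g \<alpha> = (\<lambda>(u, terminated).
     if terminated then return_pmf (u, True)
     else bind_pmf (bernoulli_pmf \<alpha>) (\<lambda>stop.
       if stop \<or> {v. (u, v) \<in> edges g} = {} then return_pmf (u, True)
       else map_pmf (\<lambda>v. (v, False)) (pmf_of_set {v. (u, v) \<in> edges g})))"

definition ppr :: "adj_graph \<Rightarrow> real \<Rightarrow> nat \<Rightarrow> nat \<Rightarrow> real" where
  "ppr g \<alpha> s t = absorption_prob (walk_step g \<alpha>) (s, False) {(t, True)}"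

definition pagerank :: "adj_graph \<Rightarrow> real \<Rightarrow> nat \<Rightarrow> real" where
  "pagerank g \<alpha> t = (\<Sum>s\<in>verts g. ppr g \<alpha> s t) / real (card (verts g))"


section \<open>Randomized algorithms in the adjacency-list model with JUMP\<close>

text \<open>
  Algorithms are structured programs for a random access machine that can query the graph.
  The machine has an integer and a real memory. Each is split into banks (arrays), and a cell
  is addressed by a bank number fixed in the program text and a computed index. Integers only
  support addition and truncated subtraction, and reals only field operations, comparison and
  conversion from integers. As usual for real RAMs there is no conversion from reals to
  integers, and there are no real constants that could carry advice.
\<close>

datatype iexp =
    INum nat
  | ICell nat iexp
  | IAdd iexp iexp
  | ISub iexp iexp

datatype rexp =
    ROfInt iexp
  | RCell nat iexp
  | RAdd rexp rexp
  | RSub rexp rexp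
  | RMul rexp rexp
  | RDiv rexp rexp

datatype bexp =
    ILess iexp iexp
  | RLess rexp rexp
  | BNot bexp
  | BAnd bexp bexp

text \<open>The first two arguments of each non-control instruction are bank and index of the
  destination cell.\<close>

datatype instr =
    ISet nat iexp iexp
  | RSet nat iexp rexp
  | DegIn nat iexp iexp
  | DegOut nat iexp iexp
  | QueryIn nat iexp iexp iexp
  | QueryOut nat iexp iexp iexp
  | Jump nat iexp
  | RandInt nat iexp iexp
  | Flip nat iexp rexp
  | IfElse bexp "instr list" "instr list"
  | While bexp "instr list"

record mem =
  imem :: "nat \<Rightarrow> nat \<Rightarrow> nat"
  rmem :: "nat \<Rightarrow> nat \<Rightarrow> real"

primrec ival :: "mem \<Rightarrow> iexp \<Rightarrow> nat" where
  "ival s (INum k) = k"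
| "ival s (ICell b e) = imem s b (ival s e)"
| "ival s (IAdd e f) = ival s e + ival s f"
| "ival s (ISub e f) = ival s e - ival s f"

primrec rval :: "mem \<Rightarrow> rexp \<Rightarrow> real" where
  "rval s (ROfInt e) = real (ival s e)"
| "rval s (RCell b e) = rmem s b (ival s e)"
| "rval s (RAdd e f) = rval s e + rval s f"
| "rval s (RSub e f) = rval s e - rval s f"
| "rval s (RMul e f) = rval s e * rval s f"
| "rval s (RDiv e f) = rval s e / rval s f"

primrec bval :: "mem \<Rightarrow> bexp \<Rightarrow> bool" where
  "bval s (ILess e f) \<longleftrightarrow> ival s e < ival s f"
| "bval s (RLess e f) \<longleftrightarrow> rval s e < rval s f"
| "bval s (BNot b) \<longleftrightarrow> \<not> bval s b"
| "bval s (BAnd b c) \<longleftrightarrow> bval s b \<and> bval s c"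

definition iwrite :: "nat \<Rightarrow> nat \<Rightarrow> nat \<Rightarrow> mem \<Rightarrow> mem" where
  "iwrite b i x s = s\<lparr>imem := (imem s)(b := (imem s b)(i := x))\<rparr>"

definition rwrite :: "nat \<Rightarrow> nat \<Rightarrow> real \<Rightarrow> mem \<Rightarrow> mem" where
  "rwrite b i x s = s\<lparr>rmem := (rmem s)(b := (rmem s b)(i := x))\<rparr>"

text \<open>Neighbours are numbered from 0; a query for a neighbour that does not exist yields 0.\<close>

definition nth_or_0 :: "nat list \<Rightarrow> nat \<Rightarrow> nat" where
  "nth_or_0 xs i = (if i < length xs then xs ! i else 0)"

definition uniform_below :: "nat \<Rightarrow> nat pmf" where
  "uniform_below k = (if k = 0 then return_pmf 0 else pmf_of_set {..<k})"

text \<open>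
  A configuration consists of the instructions still to be executed and the memory. Every
  instruction, and every evaluation of the guard of a conditional or a loop, takes one step.
  The expressions occurring in a program have a fixed size, so that this is the usual
  unit-cost measure up to a constant factor depending on the program only.
\<close>

type_synonym config = "instr list \<times> mem"

fun exec_step :: "adj_graph \<Rightarrow> config \<Rightarrow> config pmf" where
  "exec_step g ([], s) = return_pmf ([], s)"
| "exec_step g (ISet b i e # cs, s) = return_pmf (cs, iwrite b (ival s i) (ival s e) s)"
| "exec_step g (RSet b i e # cs, s) = return_pmf (cs, rwrite b (ival s i) (rval s e) s)"
| "exec_step g (DegIn b i u # cs, s) =
     return_pmf (cs, iwrite b (ival s i) (length (in_list g (ival s u))) s)"
| "exec_step g (DegOut b i u # cs, s) =
     return_pmf (cs, iwrite b (ival s i) (length (out_list g (ival s u))) s)"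
| "exec_step g (QueryIn b i u j # cs, s) =
     return_pmf (cs, iwrite b (ival s i) (nth_or_0 (in_list g (ival s u)) (ival s j)) s)"
| "exec_step g (QueryOut b i u j # cs, s) =
     return_pmf (cs, iwrite b (ival s i) (nth_or_0 (out_list g (ival s u)) (ival s j)) s)"
| "exec_step g (Jump b i # cs, s) =
     map_pmf (\<lambda>v. (cs, iwrite b (ival s i) v s)) (pmf_of_set (verts g))"
| "exec_step g (RandInt b i e # cs, s) =
     map_pmf (\<lambda>x. (cs, iwrite b (ival s i) x s)) (uniform_below (ival s e))"
| "exec_step g (Flip b i p # cs, s) =
     map_pmf (\<lambda>c. (cs, iwrite b (ival s i) (of_bool c) s)) (bernoulli_pmf (rval s p))"
| "exec_step g (IfElse b cs1 cs2 # cs, s) =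
     return_pmf ((if bval s b then cs1 else cs2) @ cs, s)"
| "exec_step g (While b cs1 # cs, s) =
     return_pmf (if bval s b then cs1 @ While b cs1 # cs else cs, s)"

text \<open>
  Integer bank 0 initially holds the target node and the number of nodes, real bank 0 holds
  the constants \<open>\<alpha>\<close>, \<open>\<epsilon>\<close> and \<open>p\<close>, and all other cells are zero. In particular the number of
  edges is not supplied. The output of a halted run is the content of cell 0 of real bank 0.
\<close>

definition init_mem :: "real \<Rightarrow> real \<Rightarrow> real \<Rightarrow> adj_graph \<Rightarrow> nat \<Rightarrow> mem" where
  "init_mem \<alpha> \<epsilon> p g t =
     \<lparr>imem = (\<lambda>b i. if b = 0 then nth_or_0 [t, card (verts g)] i else 0),
      rmem = (\<lambda>b i. if b = 0 \<and> i < 3 then [\<alpha>, \<epsilon>, p] ! i else 0)\<rparr>"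

definition estimate :: "config \<Rightarrow> real" where
  "estimate c = rmem (snd c) 0 0"

definition halted :: "config \<Rightarrow> bool" where
  "halted c \<longleftrightarrow> fst c = []"

text \<open>Runs that never halt count as failures.\<close>

definition failure_prob ::
  "real \<Rightarrow> real \<Rightarrow> real \<Rightarrow> instr list \<Rightarrow> adj_graph \<Rightarrow> nat \<Rightarrow> real" where
  "failure_prob \<alpha> \<epsilon> p P g t =
     1 - absorption_prob (exec_step g) (P, init_mem \<alpha> \<epsilon> p g t)
           {c. halted c \<and>
               \<not> \<bar>estimate c - pagerank g \<alpha> t\<bar> \<ge> \<epsilon> * pagerank g \<alpha> t}"

definition solves_single_node :: "real \<Rightarrow> real \<Rightarrow> real \<Rightarrow> instr list \<Rightarrow> bool" where
  "solves_single_node \<alpha> \<epsilon> p P \<longleftrightarrow>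
     (\<forall>g t. wf_graph g \<longrightarrow> t \<in> verts g \<longrightarrow> failure_prob \<alpha> \<epsilon> p P g t \<le> p)"

text \<open>For the number \<open>T\<close> of steps until the program halts, possibly infinite, this is
  \<open>E[T] = (\<Sum>k. Pr(T > k))\<close>.\<close>

definition expected_time ::
  "real \<Rightarrow> real \<Rightarrow> real \<Rightarrow> instr list \<Rightarrow> adj_graph \<Rightarrow> nat \<Rightarrow> ennreal" where
  "expected_time \<alpha> \<epsilon> p P g t =
     (\<Sum>k. ennreal (measure_pmf.prob
        (iterate_pmf (exec_step g) k (P, init_mem \<alpha> \<epsilon> p g t)) {c. \<not> halted c}))"

definition average_case_time ::
  "real \<Rightarrow> real \<Rightarrow> real \<Rightarrow> instr list \<Rightarrow> nat \<Rightarrow> nat \<Rightarrow> ennreal" where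
  "average_case_time \<alpha> \<epsilon> p P n m =
     (SUP g\<in>graphs n m. (\<Sum>t\<in>verts g. expected_time \<alpha> \<epsilon> p P g t) / of_nat n)"

text \<open>
  The bound is uniform in both size parameters. The factor \<open>1 + ln n\<close> and the restriction to
  \<open>m \<ge> 1\<close> avoid a vanishing bound for \<open>n = 1\<close> and for bounds such as \<open>sqrt m\<close> at \<open>m = 0\<close>.
\<close>

definition soft_O :: "(nat \<Rightarrow> nat \<Rightarrow> ennreal) \<Rightarrow> (nat \<Rightarrow> nat \<Rightarrow> real) \<Rightarrow> bool" where
  "soft_O T f \<longleftrightarrow>
     (\<exists>C k. \<forall>n\<ge>1. \<forall>m\<ge>1. T n m \<le> ennreal (C * f n m * (1 + ln (real n)) ^ k))"

end

theory Submission
  imports Defs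
begin

text \<open>
  The program combines backward push from the target with Monte Carlo sampling. Let \<open>h\<close> be the
  solution of \<open>h = r + (1 - \<alpha>) A h\<close>, where \<open>A\<close> averages over out-neighbours and \<open>r\<close> is the current
  residue; for \<open>r\<close> the unit vector of the target, \<open>h u\<close> is the expected number of visits to the
  target from \<open>u\<close>. Pushing a node \<open>v\<close> lowers \<open>h\<close> by \<open>r v\<close> at \<open>v\<close> only, at the cost of one queue entry
  per in-neighbour. A popped node \<open>v\<close> is pushed only if \<open>n * r v > L + d v\<close>, where \<open>L\<close> is the number
  of queue entries so far and \<open>d v\<close> the in-degree. Hence \<open>L\<^sup>2 + 2 n (\<Sum>v. h v * d v)\<close> never increases,
  and both \<open>L\<close> and the scaled residue \<open>n * r v\<close> of every skipped node stay below
  \<open>sqrt (1 + 2 n D\<^sub>t)\<close> for the initial value \<open>D\<^sub>t\<close> of the sum. The threshold adapts to the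
  target, so the number of edges need not be known.

  The rest of \<open>(\<Sum>u. h u) / n\<close> is estimated by the residues at the ends of random walks. Their second
  moment is at most the maximal residue over \<open>\<alpha>\<close> times the mean, so that by Chebyshev's inequality
  \<open>O(n * max r)\<close> walks suffice. Finally \<open>(\<Sum>t. D\<^sub>t) \<le> m / \<alpha>\<close>, since a walk makes at most \<open>1 / \<alpha>\<close>
  visits in expectation, and averaging \<open>sqrt (1 + 2 n D\<^sub>t)\<close> over the targets gives \<open>O(sqrt m)\<close>.
\<close>

section \<open>Weakest preexpectations\<close>

text \<open>\<open>wp g c f\<close> is the expectation of \<open>c\<close> times the number of steps plus \<open>f\<close> of the final memory;
  runs that do not halt contribute only their steps.\<close>

primrec wpk :: "adj_graph \<Rightarrow> real \<Rightarrow> (mem \<Rightarrow> ennreal) \<Rightarrow> nat \<Rightarrow> config \<Rightarrow> ennreal" where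
  "wpk g c f 0 x = (if fst x = [] then f (snd x) else 0)"
| "wpk g c f (Suc k) x =
     (if fst x = [] then f (snd x) else ennreal c + (\<integral>\<^sup>+y. wpk g c f k y \<partial>measure_pmf (exec_step g x)))"

definition wp :: "adj_graph \<Rightarrow> real \<Rightarrow> (mem \<Rightarrow> ennreal) \<Rightarrow> config \<Rightarrow> ennreal" where
  "wp g c f x = (SUP k. wpk g c f k x)"

lemma wpk_halted: "wpk g c f k ([], s) = f s"
  by (cases k) auto

lemma wpk_mono_Suc: "wpk g c f k x \<le> wpk g c f (Suc k) x"
proof (induction k arbitrary: x)
  case (Suc k)
  show ?case
    using nn_integral_mono[of "measure_pmf (exec_step g x)" "wpk g c f k" "wpk g c f (Suc k)"] Suc
    by (subst (1 2) wpk.simps) (auto intro!: add_mono)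
qed auto

lemma incseq_wpk: "incseq (\<lambda>k. wpk g c f k)"
  using wpk_mono_Suc by (intro incseq_SucI) (auto simp: le_fun_def simp del: wpk.simps)

lemma wpk_le_wp: "wpk g c f k x \<le> wp g c f x"
  unfolding wp_def by (rule SUP_upper) auto

lemma wp_mono:
  assumes "\<And>s. f s \<le> f' s"
  shows "wp g c f x \<le> wp g c f' x"
proof -
  have "wpk g c f k x \<le> wpk g c f' k x" for k x
    by (induction k arbitrary: x) (auto intro!: assms add_left_mono nn_integral_mono)
  then show ?thesis
    unfolding wp_def by (intro SUP_mono) blast
qed

lemma wp_halted [simp]: "wp g c f ([], s) = f s"
  unfolding wp_def by (simp add: wpk_halted)

text \<open>Monotone convergence moves the supremum over \<open>k\<close> through the expectation,
  so the bounded unrollings satisfy a one-step equation in the limit.\<close>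

lemma wp_step:
  assumes "cs \<noteq> []"
  shows "wp g c f (cs, s) = ennreal c + (\<integral>\<^sup>+y. wp g c f y \<partial>measure_pmf (exec_step g (cs, s)))"
proof -
  let ?M = "measure_pmf (exec_step g (cs, s))"
  have "wp g c f (cs, s) = (SUP k. wpk g c f (Suc k) (cs, s))"
    unfolding wp_def using wpk_mono_Suc[of g c f _ "(cs, s)"]
    by (intro antisym SUP_mono) (blast intro: UNIV_I)+
  also have "\<dots> = (SUP k. ennreal c + (\<integral>\<^sup>+y. wpk g c f k y \<partial>?M))"
    using assms by simp
  also have "\<dots> = ennreal c + (SUP k. \<integral>\<^sup>+y. wpk g c f k y \<partial>?M)"
    by (rule ennreal_SUP_add_right[symmetric]) simp
  also have "(SUP k. \<integral>\<^sup>+y. wpk g c f k y \<partial>?M) = (\<integral>\<^sup>+y. (SUP k. wpk g c f k y) \<partial>?M)"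
    by (intro nn_integral_monotone_convergence_SUP[symmetric] incseq_wpk) auto
  finally show ?thesis by (simp add: wp_def)
qed

lemma wp_instr:
  "wp g c f (ISet b i e # cs, s) = ennreal c + wp g c f (cs, iwrite b (ival s i) (ival s e) s)"
  "wp g c f (RSet b i x # cs, s) = ennreal c + wp g c f (cs, rwrite b (ival s i) (rval s x) s)"
  "wp g c f (DegIn b i u # cs, s) =
     ennreal c + wp g c f (cs, iwrite b (ival s i) (length (in_list g (ival s u))) s)"
  "wp g c f (DegOut b i u # cs, s) =
     ennreal c + wp g c f (cs, iwrite b (ival s i) (length (out_list g (ival s u))) s)"
  "wp g c f (QueryIn b i u j # cs, s) =
     ennreal c + wp g c f (cs, iwrite b (ival s i) (nth_or_0 (in_list g (ival s u)) (ival s j)) s)"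
  "wp g c f (QueryOut b i u j # cs, s) =
     ennreal c + wp g c f (cs, iwrite b (ival s i) (nth_or_0 (out_list g (ival s u)) (ival s j)) s)"
  "wp g c f (Jump b i # cs, s) =
     ennreal c + (\<integral>\<^sup>+v. wp g c f (cs, iwrite b (ival s i) v s) \<partial>measure_pmf (pmf_of_set (verts g)))"
  "wp g c f (RandInt b i e # cs, s) =
     ennreal c + (\<integral>\<^sup>+v. wp g c f (cs, iwrite b (ival s i) v s) \<partial>measure_pmf (uniform_below (ival s e)))"
  "wp g c f (Flip b i x # cs, s) =
     ennreal c + (\<integral>\<^sup>+v. wp g c f (cs, iwrite b (ival s i) (of_bool v) s)
       \<partial>measure_pmf (bernoulli_pmf (rval s x)))"
  "wp g c f (IfElse bx cs1 cs2 # cs, s) =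
     ennreal c + wp g c f ((if bval s bx then cs1 else cs2) @ cs, s)"
  by (subst wp_step; simp)+

section \<open>Upper bounds for loops\<close>

lemma exec_step_append:
  "exec_step g ((a # cs) @ ds, s) = map_pmf (\<lambda>(cs', s'). (cs' @ ds, s')) (exec_step g (a # cs, s))"
  by (cases a) (auto simp: map_pmf_comp)

text \<open>\<open>wp\<close> is approached from below by bounded unrollings, so any
  \<open>I\<close> that pays for one round and for the exit is an upper bound; runs that never leave
  the loop are covered too.\<close>

lemma wp_While:
  assumes guard: "\<And>s. bval s b \<Longrightarrow> ennreal c + wp g c I (body, s) \<le> I s"
    and exit: "\<And>s. \<not> bval s b \<Longrightarrow> ennreal c + wp g c f (cs, s) \<le> I s"
  shows "wp g c f (While b body # cs, s) \<le> I s"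
proof -
  \<comment> \<open>The claim is made for every remainder \<open>ds\<close> of the body, because the
    induction counts single instructions and not whole rounds.\<close>
  have *: "wpk g c f k (ds @ While b body # cs, s) \<le> wp g c I (ds, s)" for k ds s
  proof (induction k arbitrary: ds s)
    case 0
    then show ?case by simp
  next
    case (Suc k)
    show ?case
    proof (cases ds)
      case Nil
      show ?thesis
      proof (cases "bval s b")
        case True
        then have "wpk g c f (Suc k) (ds @ While b body # cs, s)
            = ennreal c + wpk g c f k (body @ While b body # cs, s)"
          using Nil by simp
        also have "\<dots> \<le> I s"
          using guard[OF True] Suc[of body s] by (meson add_left_mono order_trans)
        finally show ?thesis using Nil by simp
      next
        case False
        then have "wpk g c f (Suc k) (ds @ While b body # cs, s) = ennreal c + wpk g c f k (cs, s)"
          using Nil by simp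
        also have "\<dots> \<le> I s"
          using exit[OF False] wpk_le_wp[of g c f k "(cs, s)"] by (meson add_left_mono order_trans)
        finally show ?thesis using Nil by simp
      qed
    next
      case (Cons a ds')
      have "wpk g c f (Suc k) (ds @ While b body # cs, s) = ennreal c +
          (\<integral>\<^sup>+y. wpk g c f k (fst y @ While b body # cs, snd y) \<partial>measure_pmf (exec_step g (ds, s)))"
        unfolding Cons wpk.simps exec_step_append by (simp add: case_prod_beta)
      also have "\<dots> \<le> ennreal c + (\<integral>\<^sup>+y. wp g c I y \<partial>measure_pmf (exec_step g (ds, s)))"
        using Suc by (intro add_left_mono nn_integral_mono) (metis prod.collapse)
      also have "\<dots> = wp g c I (ds, s)"
        using Cons by (simp add: wp_step)
      finally show ?thesis .
    qed
  qed
  from *[of _ "[]"] show ?thesis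
    by (subst wp_def) (simp add: SUP_le_iff)
qed

section \<open>Expected time and failure probability as preexpectations\<close>

lemma iterate_pmf_halted: "iterate_pmf (exec_step g) k ([], s) = return_pmf ([], s)"
  by (induction k) (auto simp: bind_return_pmf)

text \<open>With \<open>c = 1\<close> and final value \<open>0\<close>, \<open>wpk\<close> adds one
  unit per step taken, which is the tail sum of the running time truncated at
  \<open>k\<close>.\<close>

lemma sum_not_halted_le_wp:
  "(\<Sum>j<k. emeasure (measure_pmf (iterate_pmf (exec_step g) j x)) {c. \<not> halted c})
     \<le> wpk g 1 (\<lambda>_. 0) k x"
proof (induction k arbitrary: x)
  case (Suc k)
  obtain cs s where x: "x = (cs, s)" by force
  show ?case
  proof (cases cs)
    case Nil
    then show ?thesis
      by (simp add: x iterate_pmf_halted halted_def del: sum.lessThan_Suc)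
  next
    case (Cons a cs')
    let ?K = "exec_step g"
    have "(\<Sum>j<Suc k. emeasure (measure_pmf (iterate_pmf ?K j x)) {c. \<not> halted c})
        = 1 + (\<Sum>j<k. emeasure (measure_pmf (iterate_pmf ?K (Suc j) x)) {c. \<not> halted c})"
      by (subst sum.lessThan_Suc_shift) (simp add: x Cons halted_def)
    also have "\<dots> = 1 + (\<integral>\<^sup>+y. (\<Sum>j<k. emeasure (measure_pmf (iterate_pmf ?K j y)) {c. \<not> halted c})
        \<partial>measure_pmf (?K x))"
      by (subst nn_integral_sum) (simp_all add: emeasure_bind_pmf)
    also have "\<dots> \<le> 1 + (\<integral>\<^sup>+y. wpk g 1 (\<lambda>_. 0) k y \<partial>measure_pmf (?K x))"
      by (intro add_left_mono nn_integral_mono Suc)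
    also have "\<dots> = wpk g 1 (\<lambda>_. 0) (Suc k) x"
      by (simp add: x Cons)
    finally show ?thesis .
  qed
qed simp

lemma expected_time_le_wp:
  "expected_time \<alpha> \<epsilon> p P g t \<le> wp g 1 (\<lambda>_. 0) (P, init_mem \<alpha> \<epsilon> p g t)"
proof -
  have "(\<Sum>j<k. ennreal (measure_pmf.prob (iterate_pmf (exec_step g) j x) {c. \<not> halted c}))
     \<le> wp g 1 (\<lambda>_. 0) x" for k x
    using sum_not_halted_le_wp[of g x k] wpk_le_wp[of g 1 "\<lambda>_. 0" k x]
    by (simp add: measure_pmf.emeasure_eq_measure)
  then show ?thesis
    unfolding expected_time_def by (subst suminf_eq_SUP) (auto intro: SUP_least)
qed

lemma prob_halted_le_wp:
  "emeasure (measure_pmf (iterate_pmf (exec_step g) k x)) {c. halted c \<and> B (snd c)}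
     \<le> wpk g 0 (indicator {s. B s}) k x"
proof (induction k arbitrary: x)
  case 0
  then show ?case by (auto simp: halted_def indicator_def)
next
  case (Suc k)
  obtain cs s where x: "x = (cs, s)" by force
  show ?case
  proof (cases cs)
    case Nil
    then show ?thesis
      by (simp only: x iterate_pmf_halted) (auto simp: halted_def indicator_def)
  next
    case (Cons a cs')
    have "emeasure (measure_pmf (iterate_pmf (exec_step g) (Suc k) x)) {c. halted c \<and> B (snd c)}
       = (\<integral>\<^sup>+y. emeasure (measure_pmf (iterate_pmf (exec_step g) k y)) {c. halted c \<and> B (snd c)}
           \<partial>measure_pmf (exec_step g x))"
      by (simp add: emeasure_bind_pmf)
    also have "\<dots> \<le> (\<integral>\<^sup>+y. wpk g 0 (indicator {s. B s}) k y \<partial>measure_pmf (exec_step g x))"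
      by (intro nn_integral_mono Suc)
    also have "\<dots> = wpk g 0 (indicator {s. B s}) (Suc k) x"
      by (simp add: x Cons)
    finally show ?thesis .
  qed
qed

text \<open>A finite expected time forces the probability of still running to tend to
  \<open>0\<close>; a run that is neither running nor bad after \<open>k\<close> steps has
  succeeded.\<close>

lemma failure_prob_le_wp:
  assumes fin: "expected_time \<alpha> \<epsilon> p P g t < \<top>"
    and bad: "wp g 0 (indicator {s. \<bar>rmem s 0 0 - pagerank g \<alpha> t\<bar> \<ge> \<epsilon> * pagerank g \<alpha> t})
           (P, init_mem \<alpha> \<epsilon> p g t) \<le> ennreal q" and q: "q \<ge> 0"
  shows "failure_prob \<alpha> \<epsilon> p P g t \<le> q"
proof -
  let ?x = "(P, init_mem \<alpha> \<epsilon> p g t)"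
  let ?B = "\<lambda>s. \<bar>rmem s 0 0 - pagerank g \<alpha> t\<bar> \<ge> \<epsilon> * pagerank g \<alpha> t"
  let ?D = "\<lambda>k. measure_pmf (iterate_pmf (exec_step g) k ?x)"
  define G where "G = {c. halted c \<and> \<not> ?B (snd c)}"
  define H where "H = {c. halted c \<and> ?B (snd c)}"
  define u where "u k = measure (?D k) {c. \<not> halted c}" for k
  define a where "a = absorption_prob (exec_step g) ?x G"
  have "summable u"
    using fin unfolding expected_time_def u_def
    by (intro summable_suminf_not_top) auto
  then have u0: "u \<longlonglongrightarrow> 0" by (rule summable_LIMSEQ_zero)
  have "1 - q - u k \<le> a" for k
  proof -
    have "ennreal (measure (?D k) {c. halted c \<and> ?B (snd c)}) \<le> ennreal q"
      using prob_halted_le_wp[of g k ?x ?B] wpk_le_wp[of g 0 "indicator {s. ?B s}" k ?x] bad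
      by (simp add: measure_pmf.emeasure_eq_measure)
    then have "measure (?D k) H \<le> q"
      using q by (simp add: H_def)
    moreover have "measure (?D k) (UNIV - {c. \<not> halted c} - H) = 1 - u k - measure (?D k) H"
      unfolding u_def H_def by (subst measure_pmf.finite_measure_Diff;
        (subst measure_pmf.finite_measure_Diff)?; auto simp: measure_pmf.prob_space[simplified])
    moreover have "UNIV - {c. \<not> halted c} - H = G"
      by (auto simp: G_def H_def)
    moreover have "measure (?D k) G \<le> a"
      unfolding a_def absorption_prob_def
      by (rule cSUP_upper) (auto intro!: bdd_aboveI[of _ 1])
    ultimately show ?thesis by simp
  qed
  moreover have "(\<lambda>k. 1 - q - u k) \<longlonglongrightarrow> 1 - q - 0"
    by (intro tendsto_intros u0)
  ultimately have "1 - q - 0 \<le> a" by (intro LIMSEQ_le_const2) auto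
  then show ?thesis
    by (simp add: failure_prob_def estimate_def a_def G_def)
qed

section \<open>Potentials of residues\<close>

text \<open>Without out-neighbours the quotient is \<open>0 / 0 = 0\<close>, as it should be for a
  walk that ends there.\<close>

definition avg_out :: "adj_graph \<Rightarrow> (nat \<Rightarrow> real) \<Rightarrow> nat \<Rightarrow> real" where
  "avg_out g h u = (\<Sum>v\<in>set (out_list g u). h v) / real (length (out_list g u))"

text \<open>A relation, so that no linear system has to be inverted: \<open>potential_visits\<close>
  gives the first solution and \<open>potential_push\<close> transforms it.\<close>

definition potential :: "adj_graph \<Rightarrow> real \<Rightarrow> (nat \<Rightarrow> real) \<Rightarrow> (nat \<Rightarrow> real) \<Rightarrow> bool" where
  "potential g \<alpha> r h \<longleftrightarrow> (\<forall>u\<in>verts g. h u = r u + (1 - \<alpha>) * avg_out g h u)"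

definition stop_prob :: "adj_graph \<Rightarrow> real \<Rightarrow> nat \<Rightarrow> real" where
  "stop_prob g \<alpha> t = (if out_list g t = [] then 1 else \<alpha>)"

text \<open>The expected number of visits to \<open>t\<close> of a walk from \<open>u\<close>, including the start: every visit
  ends the walk with probability \<open>stop_prob g \<alpha> t\<close>.\<close>

definition visits :: "adj_graph \<Rightarrow> real \<Rightarrow> nat \<Rightarrow> nat \<Rightarrow> real" where
  "visits g \<alpha> t u = ppr g \<alpha> u t / stop_prob g \<alpha> t"

locale discounted_graph =
  fixes g :: adj_graph and \<alpha> :: real
  assumes wf: "wf_graph g" and \<alpha>: "0 < \<alpha>" "\<alpha> < 1"
begin

lemma finite_verts [simp]: "finite (verts g)" and verts_nonempty [simp]: "verts g \<noteq> {}"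
  and edges_subset: "edges g \<subseteq> verts g \<times> verts g"
  and distinct_out [simp]: "distinct (out_list g u)"
  and distinct_in [simp]: "distinct (in_list g u)"
  and set_out: "set (out_list g u) = {v. (u, v) \<in> edges g}"
  and set_in: "set (in_list g u) = {v. (v, u) \<in> edges g}"
  using wf by (auto simp: wf_graph_def)

lemma card_verts_pos: "card (verts g) > 0"
  by (simp add: card_gt_0_iff)

lemma out_in_verts: "v \<in> set (out_list g u) \<Longrightarrow> v \<in> verts g"
  and in_in_verts: "v \<in> set (in_list g u) \<Longrightarrow> v \<in> verts g"
  and in_iff_out: "u \<in> set (in_list g v) \<longleftrightarrow> v \<in> set (out_list g u)"
  using edges_subset by (auto simp: set_out set_in)

lemma sum_in_degree: "(\<Sum>v\<in>verts g. length (in_list g v)) = card (edges g)"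
proof -
  have "edges g = (\<lambda>(v, u). (u, v)) ` (SIGMA v:verts g. set (in_list g v))"
    using edges_subset by (auto simp: set_in image_iff)
  then have "card (edges g) = card (SIGMA v:verts g. set (in_list g v))"
    by (simp add: card_image inj_on_def)
  also have "\<dots> = (\<Sum>v\<in>verts g. card (set (in_list g v)))"
    by (rule card_SigmaI) auto
  finally show ?thesis by (simp add: distinct_card)
qed

lemma avg_out_le:
  assumes "\<And>v. v \<in> verts g \<Longrightarrow> h v \<le> b" "0 \<le> b"
  shows "avg_out g h u \<le> b"
proof (cases "out_list g u = []")
  case False
  have "(\<Sum>v\<in>set (out_list g u). h v) \<le> real (card (set (out_list g u))) * b"
    using assms out_in_verts by (intro sum_bounded_above) auto
  then show ?thesis using False
    by (simp add: avg_out_def distinct_card field_simps)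
qed (use assms in \<open>simp add: avg_out_def\<close>)

lemma avg_out_nonneg: "(\<And>v. v \<in> verts g \<Longrightarrow> 0 \<le> h v) \<Longrightarrow> 0 \<le> avg_out g h u"
  using out_in_verts by (auto simp: avg_out_def intro!: divide_nonneg_nonneg sum_nonneg)

text \<open>Maximum principle: at a maximal node the recursion yields
  \<open>m \<le> \<alpha> * b + (1 - \<alpha>) * m\<close>, hence \<open>m \<le> b\<close>.\<close>

lemma potential_le:
  assumes h: "potential g \<alpha> r h" and r: "\<And>u. u \<in> verts g \<Longrightarrow> r u \<le> \<alpha> * b" and b: "0 \<le> b"
    and u: "u \<in> verts g"
  shows "h u \<le> b"
proof -
  \<comment> \<open>The \<open>max 0\<close> makes \<open>m\<close> a bound for the average also at
    nodes without out-neighbours, where it is \<open>0\<close>.\<close>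
  define m where "m = max 0 (Max (h ` verts g))"
  have m: "h v \<le> m" if "v \<in> verts g" for v
    using that by (simp add: m_def le_max_iff_disj)
  have m0: "0 \<le> m" by (simp add: m_def)
  have *: "h v \<le> \<alpha> * b + (1 - \<alpha>) * m" if "v \<in> verts g" for v
  proof -
    have "(1 - \<alpha>) * avg_out g h v \<le> (1 - \<alpha>) * m"
      using avg_out_le[of h m v] m m0 \<alpha> by (intro mult_left_mono) auto
    then show ?thesis using h r[OF that] that by (auto simp: potential_def)
  qed
  have "m \<le> \<alpha> * b + (1 - \<alpha>) * m"
    using * b m0 \<alpha> by (auto simp: m_def)
  then have "\<alpha> * m \<le> \<alpha> * b" by (simp add: algebra_simps)
  then show ?thesis using m[OF u] \<alpha> by simp
qed

lemma residue_le_potential: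
  assumes "potential g \<alpha> r h" "\<And>u. u \<in> verts g \<Longrightarrow> 0 \<le> h u" "u \<in> verts g"
  shows "r u \<le> h u"
  using assms avg_out_nonneg[of h u] \<alpha> by (auto simp: potential_def)

section \<open>Termination probabilities as limits of truncated walks\<close>

abbreviation "trunc k u t \<equiv> pmf (iterate_pmf (walk_step g \<alpha>) k (u, False)) (t, True)"

lemma iterate_walk_terminated:
  "iterate_pmf (walk_step g \<alpha>) k (u, True) = return_pmf (u, True)"
  by (induction k) (auto simp: walk_step_def bind_return_pmf)

text \<open>Condition on the first step: the coin, then the uniform out-neighbour. A node without
  out-neighbours ends the walk whatever the coin shows.\<close>

lemma trunc_Suc:
  "trunc (Suc k) u t =
     (if out_list g u = [] then of_bool (u = t)
      else \<alpha> * of_bool (u = t) + (1 - \<alpha>) * avg_out g (\<lambda>v. trunc k v t) u)"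
proof -
  have "walk_step g \<alpha> (u, False) = bind_pmf (bernoulli_pmf \<alpha>) (\<lambda>stop.
      if stop \<or> out_list g u = [] then return_pmf (u, True)
      else map_pmf (\<lambda>v. (v, False)) (pmf_of_set (set (out_list g u))))"
    unfolding walk_step_def set_out[symmetric] by simp
  then show ?thesis
    using \<alpha> by (simp add: bind_assoc_pmf pmf_bind avg_out_def iterate_walk_terminated
       bind_return_pmf bind_map_pmf integral_pmf_of_set distinct_card indicator_def)
qed

lemma trunc_mono: "trunc k u t \<le> trunc (Suc k) u t"
proof (induction k arbitrary: u)
  case (Suc k)
  have "avg_out g (\<lambda>v. trunc k v t) u \<le> avg_out g (\<lambda>v. trunc (Suc k) v t) u"
    unfolding avg_out_def by (intro divide_right_mono sum_mono Suc) auto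
  then show ?case
    using \<alpha> by (subst (1 2) trunc_Suc) (auto intro!: mult_left_mono)
qed simp

lemma trunc_tendsto: "(\<lambda>k. trunc k u t) \<longlonglongrightarrow> ppr g \<alpha> u t"
  unfolding ppr_def absorption_prob_def measure_pmf_single
  by (intro LIMSEQ_incseq_SUP incseq_SucI trunc_mono) (auto intro!: bdd_aboveI[of _ 1] pmf_le_1)

lemma ppr_rec:
  "ppr g \<alpha> u t =
     (if out_list g u = [] then of_bool (u = t)
      else \<alpha> * of_bool (u = t) + (1 - \<alpha>) * avg_out g (\<lambda>v. ppr g \<alpha> v t) u)"
proof -
  have "(\<lambda>k. trunc (Suc k) u t) \<longlonglongrightarrow> 
     (if out_list g u = [] then of_bool (u = t)
      else \<alpha> * of_bool (u = t) + (1 - \<alpha>) * avg_out g (\<lambda>v. ppr g \<alpha> v t) u)"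
    unfolding trunc_Suc avg_out_def
    by (auto intro!: tendsto_intros trunc_tendsto)
  moreover have "(\<lambda>k. trunc (Suc k) u t) \<longlonglongrightarrow> ppr g \<alpha> u t"
    by (rule LIMSEQ_Suc[OF trunc_tendsto])
  ultimately show ?thesis by (rule LIMSEQ_unique[symmetric])
qed

lemma ppr_nonneg: "0 \<le> ppr g \<alpha> u t"
  by (rule LIMSEQ_le_const[OF trunc_tendsto]) auto

text \<open>Terminations at different nodes are disjoint events in every truncation, and the bound
  passes to the limit.\<close>

lemma sum_ppr_le_1: "(\<Sum>t\<in>verts g. ppr g \<alpha> u t) \<le> 1"
proof (rule LIMSEQ_le_const2)
  show "(\<lambda>k. \<Sum>t\<in>verts g. trunc k u t) \<longlonglongrightarrow> (\<Sum>t\<in>verts g. ppr g \<alpha> u t)"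
    by (intro tendsto_intros trunc_tendsto)
  have "(\<Sum>t\<in>verts g. trunc k u t)
      = measure_pmf.prob (iterate_pmf (walk_step g \<alpha>) k (u, False)) ((\<lambda>t. (t, True)) ` verts g)" for k
    by (subst measure_measure_pmf_finite) (auto simp: sum.reindex inj_on_def)
  then show "\<exists>N. \<forall>k\<ge>N. (\<Sum>t\<in>verts g. trunc k u t) \<le> 1" by auto
qed

lemma stop_prob_bounds: "\<alpha> \<le> stop_prob g \<alpha> t" "0 < stop_prob g \<alpha> t" 
  using \<alpha> by (auto simp: stop_prob_def)

lemma visits_nonneg: "0 \<le> visits g \<alpha> t u"
  using ppr_nonneg stop_prob_bounds[of t] by (simp add: visits_def)

text \<open>Dividing the recursion of \<open>ppr\<close> by \<open>stop_prob\<close> turns its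
  source term at \<open>t\<close> into \<open>1\<close>, whether or not \<open>t\<close> has
  out-neighbours.\<close>

lemma potential_visits: "potential g \<alpha> (\<lambda>u. of_bool (u = t)) (visits g \<alpha> t)"
  unfolding potential_def
proof
  fix u assume "u \<in> verts g"
  have "avg_out g (visits g \<alpha> t) u = avg_out g (\<lambda>v. ppr g \<alpha> v t) u / stop_prob g \<alpha> t"
    by (simp add: avg_out_def visits_def sum_divide_distrib[symmetric])
  then show "visits g \<alpha> t u = of_bool (u = t) + (1 - \<alpha>) * avg_out g (visits g \<alpha> t) u"
    unfolding visits_def[of g \<alpha> t u] using \<alpha>
    by (subst ppr_rec) (auto simp: stop_prob_def avg_out_def field_simps)
qed

lemma visits_target: "t \<in> verts g \<Longrightarrow> 1 \<le> visits g \<alpha> t t"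
  using residue_le_potential[OF potential_visits visits_nonneg, of t t] by simp

lemma pagerank_eq_visits:
  "pagerank g \<alpha> t = stop_prob g \<alpha> t * (\<Sum>s\<in>verts g. visits g \<alpha> t s) / real (card (verts g))"
  using stop_prob_bounds(2)[of t]
  by (simp add: pagerank_def visits_def sum_divide_distrib[symmetric])

text \<open>Measures the work left for the push phase: lowering \<open>h\<close> at \<open>v\<close>
  touches every in-neighbour of \<open>v\<close>.\<close>

definition "in_load h = (\<Sum>v\<in>verts g. h v * real (length (in_list g v)))"

lemma in_load_nonneg: "(\<And>u. u \<in> verts g \<Longrightarrow> 0 \<le> h u) \<Longrightarrow> 0 \<le> in_load h"
  unfolding in_load_def by (intro sum_nonneg mult_nonneg_nonneg) auto

text \<open>Exchange the sums: for a fixed start, the visits to all targets add up to at most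
  \<open>1 / \<alpha>\<close>, and the in-degrees add up to the number of edges.\<close>

lemma sum_in_load_visits_le: "(\<Sum>t\<in>verts g. in_load (visits g \<alpha> t)) \<le> real (card (edges g)) / \<alpha>"
proof -
  have "(\<Sum>t\<in>verts g. visits g \<alpha> t v) \<le> 1 / \<alpha>" for v
  proof -
    have "(\<Sum>t\<in>verts g. visits g \<alpha> t v) \<le> (\<Sum>t\<in>verts g. ppr g \<alpha> v t / \<alpha>)"
      unfolding visits_def using stop_prob_bounds ppr_nonneg \<alpha>
      by (intro sum_mono divide_left_mono) auto
    also have "\<dots> \<le> 1 / \<alpha>"
      using sum_ppr_le_1[of v] \<alpha> by (simp add: sum_divide_distrib[symmetric] divide_right_mono)
    finally show ?thesis .
  qed
  then have "(\<Sum>v\<in>verts g. (\<Sum>t\<in>verts g. visits g \<alpha> t v) * real (length (in_list g v)))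
      \<le> (\<Sum>v\<in>verts g. 1 / \<alpha> * real (length (in_list g v)))"
    by (intro sum_mono mult_right_mono) auto
  also have "\<dots> = real (card (edges g)) / \<alpha>"
    by (simp add: sum_divide_distrib[symmetric] sum_in_degree[symmetric])
  finally show ?thesis
    unfolding in_load_def by (subst sum.swap) (simp add: sum_distrib_right)
qed

text \<open>The change of \<open>h\<close> at \<open>v\<close> alters averages at the in-neighbours
  of \<open>v\<close> only, and their new residues absorb it. The two summands of \<open>r'\<close>
  are kept apart so that a self-loop returns its share to \<open>v\<close>.\<close>

lemma potential_push:
  assumes h: "potential g \<alpha> r h"
    and r': "\<And>u. r' u = (if u = v then 0 else r u) +
        (if u \<in> set (in_list g v) then (1 - \<alpha>) * r v / real (length (out_list g u)) else 0)"
  shows "potential g \<alpha> r' (h(v := h v - r v))"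
  unfolding potential_def
proof
  fix u assume u: "u \<in> verts g"
  let ?h = "h(v := h v - r v)"
  have "(\<Sum>w\<in>set (out_list g u). ?h w)
     = (\<Sum>w\<in>set (out_list g u). h w - (if w = v then r v else 0))"
    by (intro sum.cong) auto
  also have "\<dots> = (\<Sum>w\<in>set (out_list g u). h w) - (if u \<in> set (in_list g v) then r v else 0)"
    by (simp add: sum_subtractf in_iff_out)
  finally have "avg_out g ?h u = avg_out g h u -
      (if u \<in> set (in_list g v) then r v / real (length (out_list g u)) else 0)"
    by (simp add: avg_out_def diff_divide_distrib)
  moreover have "h u = r u + (1 - \<alpha>) * avg_out g h u"
    using h u by (simp add: potential_def)
  ultimately show "?h u = r' u + (1 - \<alpha>) * avg_out g ?h u"
    by (auto simp: r' right_diff_distrib)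
qed

end

section \<open>The program\<close>

text \<open>
  Integer bank 1 holds the scalars: 0 queue length \<open>L\<close>, 1 queue head, 2 popped node, 3 its in-degree,
  4 loop index, 5 current node, 6 its out-degree, 7 number of walks done, 8 walk stopped, 9 coin.
  Integer bank 2 is the queue. Real bank 1 holds 0 the total pushed residue \<open>P\<close>, 1 the maximum \<open>M\<close> of
  \<open>n * r v\<close> over the skipped nodes, 2 the residue being pushed, 3 the sum of the samples. Real bank 2
  is the residue \<open>r\<close>.
\<close>

abbreviation iv :: "nat \<Rightarrow> iexp" where "iv k \<equiv> ICell 1 (INum k)"
abbreviation rv :: "nat \<Rightarrow> rexp" where "rv k \<equiv> RCell 1 (INum k)"
abbreviation num_nodes :: rexp where "num_nodes \<equiv> ROfInt (ICell 0 (INum 1))"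
abbreviation alpha :: rexp where "alpha \<equiv> RCell 0 (INum 0)"

definition relax_guard :: bexp where "relax_guard = ILess (iv 4) (iv 3)"

text \<open>The in-neighbour is appended even if it is already queued; so the queue length also
  counts the relaxations.\<close>

definition relax_body :: "instr list" where
  "relax_body =
    [QueryIn 1 (INum 5) (iv 2) (iv 4),
     DegOut 1 (INum 6) (iv 5),
     RSet 2 (iv 5) (RAdd (RCell 2 (iv 5))
       (RDiv (RMul (RSub (ROfInt (INum 1)) alpha) (rv 2)) (ROfInt (iv 6)))),
     ISet 2 (iv 0) (iv 5),
     ISet 1 (INum 0) (IAdd (iv 0) (INum 1)),
     ISet 1 (INum 4) (IAdd (iv 4) (INum 1))]"

definition push_guard :: bexp where "push_guard = ILess (iv 1) (iv 0)"

text \<open>The threshold is the queue length that the push would produce. A skipped node is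
  examined again only if a later push raises its residue and thereby enqueues it.\<close>

definition push_body :: "instr list" where
  "push_body =
    [ISet 1 (INum 2) (ICell 2 (iv 1)),
     ISet 1 (INum 1) (IAdd (iv 1) (INum 1)),
     DegIn 1 (INum 3) (iv 2),
     IfElse (RLess (ROfInt (IAdd (iv 0) (iv 3))) (RMul num_nodes (RCell 2 (iv 2))))
       [RSet 1 (INum 2) (RCell 2 (iv 2)),
        RSet 2 (iv 2) (ROfInt (INum 0)),
        RSet 1 (INum 0) (RAdd (rv 0) (rv 2)),
        ISet 1 (INum 4) (INum 0),
        While relax_guard relax_body]
       [IfElse (RLess (rv 1) (RMul num_nodes (RCell 2 (iv 2))))
         [RSet 1 (INum 1) (RMul num_nodes (RCell 2 (iv 2)))]
         []]]"

text \<open>A walk contributes its residue over \<open>\<alpha>\<close> if the coin stops it, and nothing if it stops for lack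
  of out-neighbours; so the sample is unbiased for \<open>h\<close> at every node.\<close>

definition walk_guard :: bexp where "walk_guard = ILess (iv 8) (INum 1)"

definition walk_body :: "instr list" where
  "walk_body =
    [Flip 1 (INum 9) alpha,
     DegOut 1 (INum 6) (iv 5),
     IfElse (ILess (INum 0) (iv 9))
       [RSet 1 (INum 3) (RAdd (rv 3) (RDiv (RCell 2 (iv 5)) alpha)),
        ISet 1 (INum 8) (INum 1)]
       [IfElse (ILess (INum 0) (iv 6))
         [RandInt 1 (INum 4) (iv 6),
          QueryOut 1 (INum 5) (iv 5) (iv 4)]
         [ISet 1 (INum 8) (INum 1)]]]"

text \<open>The counter is compared with a real number, since the machine cannot round; this amounts
  to rounding the sample size up.\<close>

definition sample_guard :: bexp where
  "sample_guard = RLess (ROfInt (iv 7))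
     (RDiv (rv 1) (RMul alpha
       (RMul (RMul (RCell 0 (INum 1)) (RCell 0 (INum 1))) (RCell 0 (INum 2)))))"

definition sample_body :: "instr list" where
  "sample_body =
    [Jump 1 (INum 5),
     ISet 1 (INum 8) (INum 0),
     While walk_guard walk_body,
     ISet 1 (INum 7) (IAdd (iv 7) (INum 1))]"

text \<open>No walk is made only if all residues vanish; then division by zero gives the right term \<open>0\<close>.\<close>

definition output_code :: "instr list" where
  "output_code =
    [DegOut 1 (INum 6) (ICell 0 (INum 0)),
     IfElse (ILess (INum 0) (iv 6))
       [RSet 0 (INum 0) (RMul alpha (RAdd (RDiv (rv 0) num_nodes) (RDiv (rv 3) (ROfInt (iv 7)))))]
       [RSet 0 (INum 0) (RAdd (RDiv (rv 0) num_nodes) (RDiv (rv 3) (ROfInt (iv 7))))]]"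

definition pagerank_program :: "instr list" where
  "pagerank_program =
    [ISet 2 (INum 0) (ICell 0 (INum 0)),
     ISet 1 (INum 0) (INum 1),
     RSet 2 (ICell 0 (INum 0)) (ROfInt (INum 1)),
     While push_guard push_body,
     While sample_guard sample_body] @ output_code"

section \<open>Analysis of the sampling phase\<close>

lemma nn_integral_pmf_of_set_le:
  assumes "finite S" "S \<noteq> {}" "\<And>x. x \<in> S \<Longrightarrow> F x \<le> ennreal (f x)" "\<And>x. x \<in> S \<Longrightarrow> 0 \<le> f x"
  shows "(\<integral>\<^sup>+x. F x \<partial>measure_pmf (pmf_of_set S)) \<le> ennreal ((\<Sum>x\<in>S. f x) / real (card S))"
proof -
  have "(\<integral>\<^sup>+x. F x \<partial>measure_pmf (pmf_of_set S)) \<le> (\<integral>\<^sup>+x. ennreal (f x) \<partial>measure_pmf (pmf_of_set S))"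
    using assms by (intro nn_integral_mono_AE) (auto simp: AE_measure_pmf_iff)
  also have "\<dots> = ennreal (\<integral>x. f x \<partial>measure_pmf (pmf_of_set S))"
    using assms by (intro nn_integral_eq_integral integrable_measure_pmf_finite)
      (auto simp: AE_measure_pmf_iff)
  finally show ?thesis using assms by (simp add: integral_pmf_of_set)
qed

lemma ennreal_add_le:
  assumes "X \<le> ennreal x" "0 \<le> x" "0 \<le> c" "c + x \<le> y"
  shows "ennreal c + X \<le> ennreal y"
proof -
  have "ennreal c + X \<le> ennreal (c + x)"
    using assms by (simp add: add_left_mono)
  also have "\<dots> \<le> ennreal y" using assms by (intro ennreal_leI)
  finally show ?thesis .
qed

locale single_node = discounted_graph +
  fixes t :: nat and \<epsilon> p c \<kappa> :: real
  assumes t: "t \<in> verts g" and \<epsilon>: "0 < \<epsilon>" and p: "0 < p" and c: "0 \<le> c" and \<kappa>: "0 \<le> \<kappa>"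
begin

abbreviation n :: nat where "n \<equiv> card (verts g)"
abbreviation w :: real where "w \<equiv> stop_prob g \<alpha> t"
abbreviation \<pi> :: real where "\<pi> \<equiv> pagerank g \<alpha> t"

text \<open>The instance \<open>c = 1\<close>, \<open>\<kappa> = 0\<close> bounds the expected time, and \<open>c = 0\<close>, \<open>\<kappa> = 1 / (\<epsilon> * \<pi>)\<^sup>2\<close>
  the failure probability.\<close>

definition post :: "mem \<Rightarrow> ennreal" where "post s = ennreal (\<kappa> * (rmem s 0 0 - \<pi>)\<^sup>2)"

definition input_intact :: "mem \<Rightarrow> bool" where
  "input_intact s \<longleftrightarrow> imem s 0 0 = t \<and> imem s 0 1 = n \<and>
     rmem s 0 0 = \<alpha> \<and> rmem s 0 1 = \<epsilon> \<and> rmem s 0 2 = p"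

lemma n_pos: "0 < real n" using card_verts_pos by simp

text \<open>The walk that starts at \<open>t\<close> already visits \<open>t\<close> once.\<close>

lemma w_le_pagerank: "w / real n \<le> \<pi>"
proof -
  have "1 \<le> visits g \<alpha> t t" by (rule visits_target[OF t])
  also have "\<dots> \<le> (\<Sum>u\<in>verts g. visits g \<alpha> t u)"
    using t visits_nonneg by (intro member_le_sum) auto
  finally have "w * 1 / real n \<le> \<pi>"
    unfolding pagerank_eq_visits using stop_prob_bounds[of t]
    by (intro divide_right_mono mult_left_mono) auto
  then show ?thesis by simp
qed

text \<open>The size that Chebyshev's inequality asks for: the variance of the output becomes at
  most \<open>\<epsilon>\<^sup>2 * p * \<pi>\<^sup>2\<close>.\<close>

definition num_samples :: "real \<Rightarrow> nat" where
  "num_samples M = nat \<lceil>M / (\<alpha> * (\<epsilon> * \<epsilon> * p))\<rceil>"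

text \<open>A walk has at most \<open>1 / \<alpha>\<close> rounds in expectation, each of at most 7
  steps with its guard. The 5 pays for the sampling guard, the jump, the flag reset, the last walk
  guard and the counter.\<close>

definition sample_cost :: real where "sample_cost = 5 + 7 / \<alpha>"

lemma sample_cost_nonneg: "0 \<le> sample_cost"
  using \<alpha> by (simp add: sample_cost_def)

end

text \<open>What the sampling phase may assume of the push phase. The machine stores
  \<open>r\<close>, \<open>P\<close> and \<open>M\<close>, whereas \<open>h\<close> exists in the
  analysis only.\<close>

locale pushed = single_node +
  fixes r h :: "nat \<Rightarrow> real" and P M :: real
  assumes pot: "potential g \<alpha> r h"
    and h_nonneg: "\<And>u. u \<in> verts g \<Longrightarrow> 0 \<le> h u"
    and r_nonneg: "\<And>u. u \<in> verts g \<Longrightarrow> 0 \<le> r u"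
    and r_le: "\<And>u. u \<in> verts g \<Longrightarrow> real n * r u \<le> M"
    and mass: "(\<Sum>u\<in>verts g. h u) + P = (\<Sum>u\<in>verts g. visits g \<alpha> t u)"
    and P_nonneg: "0 \<le> P" and M_nonneg: "0 \<le> M"
begin

text \<open>\<open>\<mu>\<close> is the mean of one sample, \<open>R\<close> bounds a sample, and
  \<open>K\<close> converts the squared error of the sample sum into that of the output.\<close>

definition \<mu> :: real where "\<mu> = (\<Sum>u\<in>verts g. h u) / real n"
definition R :: real where "R = M / (real n * \<alpha>)"
abbreviation N :: nat where "N \<equiv> num_samples M"
definition K :: real where "K = \<kappa> * (w / real N)\<^sup>2"

lemma K_nonneg: "0 \<le> K" using \<kappa> by (simp add: K_def)
lemma \<mu>_nonneg: "0 \<le> \<mu>" unfolding \<mu>_def by (intro divide_nonneg_nonneg sum_nonneg h_nonneg) auto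
lemma R_nonneg: "0 \<le> R" using M_nonneg \<alpha> by (simp add: R_def)

lemma r_le_R: "u \<in> verts g \<Longrightarrow> r u \<le> \<alpha> * R"
  using r_le[of u] \<alpha> n_pos by (simp add: R_def field_simps)

lemma h_le_R: "u \<in> verts g \<Longrightarrow> h u \<le> R"
  using potential_le[OF pot r_le_R R_nonneg] .

lemma pagerank_eq: "\<pi> = w * (P / real n + \<mu>)"
  unfolding pagerank_eq_visits mass[symmetric] \<mu>_def by (simp add: add_divide_distrib algebra_simps)

section \<open>Invariants of the sampling loop and of a single walk\<close>

definition intact :: "mem \<Rightarrow> bool" where
  "intact s \<longleftrightarrow> input_intact s \<and> rmem s 2 = r \<and> rmem s 1 0 = P \<and> rmem s 1 1 = M"

text \<open>The remaining cost plus the squared deviation after \<open>k\<close> samples with sum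
  \<open>A\<close>, where each missing sample adds at most \<open>R * \<mu>\<close> of variance. The
  4 is the exit guard and the output code.\<close>

definition sample_val :: "nat \<Rightarrow> real \<Rightarrow> real" where
  "sample_val k A = c * (sample_cost * (real N - real k) + 4)
     + K * ((A - real k * \<mu>)\<^sup>2 + (real N - real k) * (R * \<mu>))"

text \<open>The value \<open>\<top>\<close> outside the intended states makes the premises of the
  loop rule trivial there.\<close>

definition sample_inv :: "mem \<Rightarrow> ennreal" where
  "sample_inv s = (if intact s \<and> imem s 1 7 \<le> N then ennreal (sample_val (imem s 1 7) (rmem s 1 3))
     else \<top>)"

lemma sample_val_nonneg: "k \<le> N \<Longrightarrow> 0 \<le> sample_val k A"
  unfolding sample_val_def using c K_nonneg \<mu>_nonneg R_nonneg sample_cost_nonneg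
  by (intro add_nonneg_nonneg mult_nonneg_nonneg) auto

text \<open>An upper bound for \<open>E (a + X)\<^sup>2\<close>, where \<open>X\<close> is the sample of a walk from \<open>u\<close>, using
  \<open>E X\<^sup>2 \<le> R * E X\<close>.\<close>

definition walk_quad :: "real \<Rightarrow> nat \<Rightarrow> real" where
  "walk_quad a u = a\<^sup>2 + (2 * a + R) * h u"

lemma walk_quad_nonneg:
  assumes "u \<in> verts g" shows "0 \<le> walk_quad a u"
proof -
  have "(h u)\<^sup>2 \<le> R * h u"
    using h_le_R[OF assms] h_nonneg[OF assms] by (simp add: power2_eq_square mult_right_mono)
  moreover have "0 \<le> (a + h u)\<^sup>2" by simp
  ultimately show ?thesis by (simp add: walk_quad_def power2_eq_square algebra_simps)
qed

lemma avg_out_walk_quad: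
  assumes "out_list g u \<noteq> []"
  shows "avg_out g (walk_quad a) u = a\<^sup>2 + (2 * a + R) * avg_out g h u"
  using assms by (simp add: avg_out_def walk_quad_def sum.distrib sum_distrib_left[symmetric]
      distinct_card add_divide_distrib)

text \<open>The square of the sample is linearised by \<open>r u / \<alpha> \<le> R\<close>; the
  rest is the recursion of \<open>h\<close>.\<close>

lemma walk_quad_step:
  assumes "u \<in> verts g"
  shows "\<alpha> * (a + r u / \<alpha>)\<^sup>2 + (1 - \<alpha>) * (if out_list g u = [] then a\<^sup>2 else avg_out g (walk_quad a) u)
    \<le> walk_quad a u"
proof -
  have hu: "h u = r u + (1 - \<alpha>) * avg_out g h u"
    using pot assms by (simp add: potential_def)
  have "(if out_list g u = [] then a\<^sup>2 else avg_out g (walk_quad a) u) = a\<^sup>2 + (2 * a + R) * avg_out g h u"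
    using avg_out_walk_quad by (simp add: avg_out_def)
  moreover have "\<alpha> * (a + r u / \<alpha>)\<^sup>2 = \<alpha> * a\<^sup>2 + 2 * a * r u + r u * (r u / \<alpha>)"
    using \<alpha> by (simp add: power2_eq_square field_simps)
  moreover have "r u * (r u / \<alpha>) \<le> r u * R"
    using r_le_R[OF assms] r_nonneg[OF assms] \<alpha> by (intro mult_left_mono) (auto simp: field_simps)
  ultimately show ?thesis
    unfolding walk_quad_def by (subst hu) (simp add: algebra_simps)
qed

text \<open>\<open>Suc k\<close> occurs because the walk in progress already counts as a sample. The
  6 is the last walk guard, the counter and the 4 of \<open>sample_val\<close>.\<close>

definition walk_val :: "nat \<Rightarrow> real \<Rightarrow> nat \<Rightarrow> real" where
  "walk_val k A u = c * (7 / \<alpha> + 6 + sample_cost * (real N - real (Suc k)))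
     + K * (walk_quad (A - real (Suc k) * \<mu>) u + (real N - real (Suc k)) * (R * \<mu>))"

definition stopped_val :: "nat \<Rightarrow> real \<Rightarrow> real" where
  "stopped_val k A = 2 * c + sample_val (Suc k) A"

definition walk_inv :: "mem \<Rightarrow> ennreal" where
  "walk_inv s = (if intact s \<and> imem s 1 7 < N \<and> (imem s 1 8 = 0 \<longrightarrow> imem s 1 5 \<in> verts g)
     then ennreal (if imem s 1 8 = 0 then walk_val (imem s 1 7) (rmem s 1 3) (imem s 1 5)
       else stopped_val (imem s 1 7) (rmem s 1 3))
     else \<top>)"

lemma walk_val_nonneg: "k < N \<Longrightarrow> u \<in> verts g \<Longrightarrow> 0 \<le> walk_val k A u"
  unfolding walk_val_def
  using c K_nonneg \<mu>_nonneg R_nonneg sample_cost_nonneg walk_quad_nonneg[of u] \<alpha>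
  by (intro add_nonneg_nonneg mult_nonneg_nonneg) auto

lemma stopped_val_nonneg: "k < N \<Longrightarrow> 0 \<le> stopped_val k A"
  unfolding stopped_val_def using c sample_val_nonneg[of "Suc k" A] by auto

lemma walk_val_step:
  assumes u: "u \<in> verts g"
  shows "7 * c + \<alpha> * stopped_val k (A + r u / \<alpha>)
     + (1 - \<alpha>) * (if out_list g u = [] then stopped_val k A else avg_out g (walk_val k A) u)
    \<le> walk_val k A u"
proof -
  define a where "a = A - real (Suc k) * \<mu>"
  define C where "C = c * (sample_cost * (real N - real (Suc k)) + 6)
     + K * ((real N - real (Suc k)) * (R * \<mu>))"
  have s: "stopped_val k B = C + K * (B - A + a)\<^sup>2" for B
    unfolding stopped_val_def sample_val_def C_def a_def by (simp add: algebra_simps)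
  have w: "walk_val k A = (\<lambda>v. C + 7 * c / \<alpha> + K * walk_quad a v)"
    unfolding walk_val_def C_def a_def by (simp add: algebra_simps fun_eq_iff)
  let ?q = "if out_list g u = [] then a\<^sup>2 else avg_out g (walk_quad a) u"
  have "(if out_list g u = [] then stopped_val k A else avg_out g (walk_val k A) u)
      \<le> C + 7 * c / \<alpha> + K * ?q"
    using c \<alpha> by (auto simp: s w avg_out_def sum.distrib distinct_card add_divide_distrib
      sum_distrib_left[symmetric])
  then have "(1 - \<alpha>) * (if out_list g u = [] then stopped_val k A else avg_out g (walk_val k A) u)
      \<le> (1 - \<alpha>) * (C + 7 * c / \<alpha> + K * ?q)"
    using \<alpha> by (intro mult_left_mono) auto
  moreover have "K * (\<alpha> * (a + r u / \<alpha>)\<^sup>2 + (1 - \<alpha>) * ?q) \<le> K * walk_quad a u"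
    by (intro mult_left_mono walk_quad_step u K_nonneg)
  moreover have "stopped_val k (A + r u / \<alpha>) = C + K * (a + r u / \<alpha>)\<^sup>2"
    by (simp add: s add.commute)
  \<comment> \<open>Geometric balance: a round costs \<open>7 * c\<close>, and the reserve
    \<open>7 * c / \<alpha>\<close> is required again only with probability
    \<open>1 - \<alpha>\<close>.\<close>
  moreover have "7 * c + \<alpha> * C + (1 - \<alpha>) * (C + 7 * c / \<alpha>) = C + 7 * c / \<alpha>"
    using \<alpha> by (simp add: field_simps)
  ultimately show ?thesis
    by (simp add: w algebra_simps)
qed

lemma walk_body_le:
  assumes s: "intact s" "imem s 1 7 < N" "imem s 1 8 = 0" "imem s 1 5 \<in> verts g"
  shows "ennreal c + wp g c walk_inv (walk_body, s) \<le> walk_inv s"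
proof -
  define k A u where "k = imem s 1 7" and "A = rmem s 1 3" and "u = imem s 1 5"
  have k: "k < N" and u: "u \<in> verts g" using s by (auto simp: k_def u_def)
  let ?d = "length (out_list g u)"
  \<comment> \<open>The memory after coin \<open>b\<close> and the degree query;
    \<open>drop 2 walk_body\<close> is the code that remains.\<close>
  let ?s = "\<lambda>b. iwrite 1 6 ?d (iwrite 1 9 (of_bool b) s)"
  define moved where "moved = (if out_list g u = [] then stopped_val k A else avg_out g (walk_val k A) u)"
  have moved0: "0 \<le> moved"
    using walk_val_nonneg[OF k] stopped_val_nonneg[OF k] by (auto simp: moved_def intro: avg_out_nonneg)
  have rs: "rmem s 0 0 = \<alpha>" "rmem s 2 = r" using s by (auto simp: intact_def input_intact_def)
  have stop: "wp g c walk_inv (drop 2 walk_body, ?s True) \<le> ennreal (3 * c + stopped_val k (A + r u / \<alpha>))"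
    using s c stopped_val_nonneg[OF k, of "A + r u / \<alpha>"] rs
    by (simp add: walk_body_def wp_instr iwrite_def rwrite_def walk_inv_def intact_def input_intact_def
       k_def A_def u_def ennreal_plus[symmetric] del: ennreal_plus)
  have move: "wp g c walk_inv (drop 2 walk_body, ?s False) \<le> ennreal (4 * c + moved)"
  proof (cases "out_list g u = []")
    case True
    then show ?thesis
      using s c stopped_val_nonneg[OF k, of A]
      by (simp add: walk_body_def wp_instr iwrite_def rwrite_def walk_inv_def intact_def input_intact_def
        moved_def k_def A_def u_def ennreal_plus[symmetric] ennreal_leI del: ennreal_plus)
  next
    case False
    let ?F = "\<lambda>j. wp g c walk_inv ([QueryOut 1 (INum 5) (iv 5) (iv 4)], iwrite 1 4 j (?s False))"
    have F: "?F j \<le> ennreal (c + walk_val k A (out_list g u ! j))" if "j < ?d" for j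
    proof -
      have "out_list g u ! j \<in> verts g" using that out_in_verts nth_mem by blast
      then show ?thesis
        using s c that walk_val_nonneg[OF k, of "out_list g u ! j" A]
        by (simp add: wp_instr iwrite_def rwrite_def walk_inv_def intact_def input_intact_def nth_or_0_def
          k_def A_def u_def ennreal_plus[symmetric] del: ennreal_plus)
    qed
    have "(\<integral>\<^sup>+j. ?F j \<partial>measure_pmf (pmf_of_set {..<?d}))
        \<le> ennreal ((\<Sum>j<?d. c + walk_val k A (out_list g u ! j)) / real (card {..<?d}))"
      using False c F walk_val_nonneg[OF k] out_in_verts[OF nth_mem]
      by (intro nn_integral_pmf_of_set_le) (auto simp: lessThan_empty_iff intro!: add_nonneg_nonneg)
    also have "(\<Sum>j<?d. walk_val k A (out_list g u ! j)) = (\<Sum>v\<in>set (out_list g u). walk_val k A v)"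
      by (rule sum.reindex_bij_betw[OF bij_betw_nth]) auto
    then have "(\<Sum>j<?d. c + walk_val k A (out_list g u ! j)) / real (card {..<?d}) = c + moved"
      using False by (simp add: sum.distrib add_divide_distrib moved_def avg_out_def)
    finally have *: "(\<integral>\<^sup>+j. ?F j \<partial>measure_pmf (pmf_of_set {..<?d})) \<le> ennreal (c + moved)" .
    have "wp g c walk_inv (drop 2 walk_body, ?s False)
       = ennreal c + (ennreal c + (ennreal c + (\<integral>\<^sup>+j. ?F j \<partial>measure_pmf (pmf_of_set {..<?d}))))"
      using False by (simp add: walk_body_def wp_instr uniform_below_def) (simp add: iwrite_def)
    also have "\<dots> \<le> ennreal (4 * c + moved)"
      using * c moved0
      by (intro ennreal_add_le[of _ "3 * c + moved"] ennreal_add_le[of _ "2 * c + moved"]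
        ennreal_add_le[of _ "c + moved"]) auto
    finally show ?thesis .
  qed
  have stop': "ennreal c + wp g c walk_inv (drop 2 walk_body, ?s True)
      \<le> ennreal (4 * c + stopped_val k (A + r u / \<alpha>))"
    by (rule ennreal_add_le[OF stop]) (use c stopped_val_nonneg[OF k] in auto)
  have move': "ennreal c + wp g c walk_inv (drop 2 walk_body, ?s False) \<le> ennreal (5 * c + moved)"
    by (rule ennreal_add_le[OF move]) (use c moved0 in auto)
  have "wp g c walk_inv (walk_body, s) =
      ennreal c + (\<integral>\<^sup>+b. ennreal c + wp g c walk_inv (drop 2 walk_body, ?s b) \<partial>measure_pmf (bernoulli_pmf \<alpha>))"
    using rs by (simp add: walk_body_def wp_instr) (simp add: iwrite_def u_def)
  also have "\<dots> = ennreal c +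
     ((ennreal c + wp g c walk_inv (drop 2 walk_body, ?s True)) * ennreal \<alpha> +
      (ennreal c + wp g c walk_inv (drop 2 walk_body, ?s False)) * ennreal (1 - \<alpha>))"
    using \<alpha> by simp
  also have "\<dots> \<le> ennreal c + (ennreal (4 * c + stopped_val k (A + r u / \<alpha>)) * ennreal \<alpha> +
      ennreal (5 * c + moved) * ennreal (1 - \<alpha>))"
    using stop' move' by (intro add_left_mono add_mono mult_right_mono) auto
  also have "\<dots> = ennreal (c + (4 * c + stopped_val k (A + r u / \<alpha>)) * \<alpha> + (5 * c + moved) * (1 - \<alpha>))"
    using c moved0 stopped_val_nonneg[OF k] \<alpha>
    by (simp add: ennreal_mult[symmetric] ennreal_plus[symmetric] del: ennreal_plus)
  finally have "ennreal c + wp g c walk_inv (walk_body, s) \<le> ennreal (walk_val k A u)"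
  proof (rule ennreal_add_le)
    have "c * \<alpha> \<le> c" "0 \<le> c * \<alpha>" using c \<alpha> by (auto simp: mult_left_le)
    then show "c + (c + (4 * c + stopped_val k (A + r u / \<alpha>)) * \<alpha> + (5 * c + moved) * (1 - \<alpha>)) \<le> walk_val k A u"
      using walk_val_step[OF u, of k A] by (simp add: moved_def[symmetric] algebra_simps)
  qed (use c moved0 stopped_val_nonneg[OF k] \<alpha> in auto)
  then show ?thesis using s by (simp add: walk_inv_def k_def A_def u_def)
qed

lemma walk_loop_le:
  "wp g c sample_inv
     ([While walk_guard walk_body, ISet 1 (INum 7) (IAdd (iv 7) (INum 1))], s) \<le> walk_inv s"
proof (rule wp_While)
  fix s assume "bval s walk_guard"
  then show "ennreal c + wp g c walk_inv (walk_body, s) \<le> walk_inv s"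
    using walk_body_le[of s] by (cases "walk_inv s = \<top>") (auto simp: walk_guard_def walk_inv_def split: if_splits)
next
  fix s assume "\<not> bval s walk_guard"
  then have stopped: "imem s 1 8 \<noteq> 0" by (simp add: walk_guard_def)
  show "ennreal c + wp g c sample_inv ([ISet 1 (INum 7) (IAdd (iv 7) (INum 1))], s) \<le> walk_inv s"
  proof (cases "intact s \<and> imem s 1 7 < N")
    case True
    then show ?thesis using stopped c sample_val_nonneg[of "Suc (imem s 1 7)" "rmem s 1 3"]
      by (simp add: wp_instr iwrite_def walk_inv_def sample_inv_def intact_def input_intact_def
        stopped_val_def ennreal_plus[symmetric] Suc_le_eq del: ennreal_plus)
  qed (auto simp: walk_inv_def stopped)
qed

text \<open>A uniform start averages \<open>h\<close> to \<open>\<mu>\<close>, so the deviation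
  changes by a term of mean zero; completing the square leaves \<open>- \<mu>\<^sup>2\<close>, which
  is dropped.\<close>

lemma avg_walk_val:
  "3 * c + (\<Sum>u\<in>verts g. walk_val k A u) / real n \<le> sample_val k A"
proof -
  define a where "a = A - real (Suc k) * \<mu>"
  define C where "C = c * (7 / \<alpha> + 6 + sample_cost * (real N - real (Suc k)))
     + K * ((real N - real (Suc k)) * (R * \<mu>))"
  have "(\<Sum>u\<in>verts g. walk_quad a u) / real n = a\<^sup>2 + (2 * a + R) * \<mu>"
    using n_pos unfolding walk_quad_def \<mu>_def
    by (simp add: sum.distrib sum_distrib_left[symmetric] add_divide_distrib)
  moreover have "walk_val k A = (\<lambda>u. C + K * walk_quad a u)"
    by (simp add: walk_val_def C_def a_def algebra_simps fun_eq_iff)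
  ultimately have "(\<Sum>u\<in>verts g. walk_val k A u) / real n = C + K * (a\<^sup>2 + (2 * a + R) * \<mu>)"
    using n_pos by (simp add: sum.distrib sum_distrib_left[symmetric] add_divide_distrib)
      (simp add: times_divide_eq_right[symmetric] del: times_divide_eq_right)
  moreover have "K * (a\<^sup>2 + (2 * a + R) * \<mu>) \<le> K * ((A - real k * \<mu>)\<^sup>2 + R * \<mu>)"
    by (intro mult_left_mono K_nonneg) (simp add: a_def power2_eq_square algebra_simps)
  ultimately show ?thesis
    by (simp add: C_def sample_val_def sample_cost_def algebra_simps add_divide_distrib)
qed

lemma sample_body_le:
  assumes s: "intact s" "imem s 1 7 < N"
  shows "ennreal c + wp g c sample_inv (sample_body, s) \<le> sample_inv s"
proof -
  define k A where "k = imem s 1 7" and "A = rmem s 1 3"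
  let ?s = "\<lambda>u. iwrite 1 8 0 (iwrite 1 5 u s)"
  let ?F = "\<lambda>u. ennreal c + wp g c sample_inv
     ([While walk_guard walk_body, ISet 1 (INum 7) (IAdd (iv 7) (INum 1))], ?s u)"
  have k: "k < N" using s by (simp add: k_def)
  have F: "?F u \<le> ennreal (c + walk_val k A u)" if "u \<in> verts g" for u
  proof (rule ennreal_add_le)
    show "wp g c sample_inv
       ([While walk_guard walk_body, ISet 1 (INum 7) (IAdd (iv 7) (INum 1))], ?s u)
       \<le> ennreal (walk_val k A u)"
      using walk_loop_le[of "?s u"] s that
      by (simp add: walk_inv_def iwrite_def intact_def input_intact_def k_def A_def)
  qed (use c walk_val_nonneg[OF k that] in auto)
  have "(\<integral>\<^sup>+u. ?F u \<partial>measure_pmf (pmf_of_set (verts g)))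
      \<le> ennreal ((\<Sum>u\<in>verts g. c + walk_val k A u) / real n)"
    using F c walk_val_nonneg[OF k] by (intro nn_integral_pmf_of_set_le) auto
  also have "(\<Sum>u\<in>verts g. c + walk_val k A u) / real n
      = c + (\<Sum>u\<in>verts g. walk_val k A u) / real n"
    using n_pos by (simp add: sum.distrib add_divide_distrib)
  finally have "ennreal c + (ennreal c + (\<integral>\<^sup>+u. ?F u \<partial>measure_pmf (pmf_of_set (verts g))))
      \<le> ennreal (3 * c + (\<Sum>u\<in>verts g. walk_val k A u) / real n)"
    using c walk_val_nonneg[OF k] n_pos
    by (intro ennreal_add_le[of _ "2 * c + (\<Sum>u\<in>verts g. walk_val k A u) / real n"]
      ennreal_add_le[of _ "c + (\<Sum>u\<in>verts g. walk_val k A u) / real n"])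
      (auto intro!: add_nonneg_nonneg divide_nonneg_nonneg sum_nonneg)
  also have "\<dots> \<le> ennreal (sample_val k A)" by (intro ennreal_leI avg_walk_val)
  also have "\<dots> = sample_inv s" using s by (simp add: sample_inv_def k_def A_def)
  also have "ennreal c + (\<integral>\<^sup>+u. ?F u \<partial>measure_pmf (pmf_of_set (verts g)))
      = wp g c sample_inv (sample_body, s)"
    by (simp add: sample_body_def wp_instr)
  finally show ?thesis .
qed

lemma sample_guard_iff:
  assumes "intact s" shows "bval s sample_guard \<longleftrightarrow> imem s 1 7 < N"
  using assms
  by (simp add: sample_guard_def intact_def input_intact_def num_samples_def
    zless_nat_eq_int_zless less_ceiling_iff)

lemma output_val:
  "\<kappa> * (w * (P / real n + A / real N) - \<pi>)\<^sup>2 = K * (A - real N * \<mu>)\<^sup>2"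
proof (cases "N = 0")
  case True
  have "0 < \<alpha> * (\<epsilon> * \<epsilon> * p)" using \<alpha> \<epsilon> p by simp
  \<comment> \<open>Without samples all residues vanish, so the maximum principle gives
    \<open>h = 0\<close> and the pushed mass alone is exact.\<close>
  with True M_nonneg have "M = 0"
    by (simp add: num_samples_def divide_le_0_iff)
  then have "R = 0" unfolding R_def by simp
  then have "h u = 0" if "u \<in> verts g" for u
    using h_le_R[OF that] h_nonneg[OF that] by simp
  then have "\<mu> = 0" by (simp add: \<mu>_def)
  then show ?thesis using True by (simp add: pagerank_eq K_def)
next
  case False
  have "w * (P / real n + A / real N) - \<pi> = (w / real N) * (A - real N * \<mu>)"
    using False by (simp add: pagerank_eq algebra_simps)
  then show ?thesis by (simp only: K_def power_mult_distrib mult.assoc)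
qed

lemma output_le:
  assumes s: "intact s" "imem s 1 7 = N"
  shows "ennreal c + wp g c post (output_code, s) \<le> sample_inv s"
proof -
  define A where "A = rmem s 1 3"
  have "ennreal c + wp g c post (output_code, s) =
      ennreal (4 * c + \<kappa> * (w * (P / real n + A / real N) - \<pi>)\<^sup>2)"
    using s c \<kappa> \<alpha> by (auto simp: output_code_def wp_instr iwrite_def rwrite_def post_def intact_def
      input_intact_def A_def stop_prob_def ennreal_plus[symmetric] simp del: ennreal_plus)
  also have "\<dots> = sample_inv s"
    using s output_val[of A]
    by (simp add: sample_inv_def sample_val_def A_def mult.commute[of c])
  finally show ?thesis by simp
qed

lemma sampling_le:
  "wp g c post (While sample_guard sample_body # output_code, s) \<le> sample_inv s"
proof (rule wp_While)
  fix s assume "bval s sample_guard"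
  then show "ennreal c + wp g c sample_inv (sample_body, s) \<le> sample_inv s"
    using sample_body_le[of s] sample_guard_iff[of s] by (cases "sample_inv s = \<top>") (auto simp: sample_inv_def)
next
  fix s assume "\<not> bval s sample_guard"
  then show "ennreal c + wp g c post (output_code, s) \<le> sample_inv s"
    using output_le[of s] sample_guard_iff[of s] by (cases "sample_inv s = \<top>") (auto simp: sample_inv_def)
qed

text \<open>Two lower bounds for \<open>\<pi>\<close> make the variance relative:
  \<open>w * \<mu> \<le> \<pi>\<close> absorbs the mean and \<open>w / n \<le> \<pi>\<close> the
  bound on a sample.\<close>

lemma sample_val_start_le:
  "sample_val 0 0 \<le> c * (sample_cost * real N + 4) + \<kappa> * (\<epsilon>\<^sup>2 * p * \<pi>\<^sup>2)"
proof -
  have "K * (real N * (R * \<mu>)) \<le> \<kappa> * (\<epsilon>\<^sup>2 * p * \<pi>\<^sup>2)"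
  proof (cases "N = 0")
    case False
    have w0: "0 < w" by (rule stop_prob_bounds)
    have den: "0 < \<alpha> * (\<epsilon> * \<epsilon> * p)" using \<alpha> \<epsilon> p by simp
    have "M / (\<alpha> * (\<epsilon> * \<epsilon> * p)) \<le> real N" 
      unfolding num_samples_def by (rule real_nat_ceiling_ge)
    then have "R / real N \<le> \<epsilon>\<^sup>2 * p / real n"
      using False den n_pos \<alpha> by (simp add: R_def field_simps power2_eq_square)
    moreover have "w * \<mu> \<le> \<pi>"
      using P_nonneg w0 n_pos by (simp add: pagerank_eq distrib_left)
    ultimately have "(w * (R / real N)) * (w * \<mu>) \<le> (w * (\<epsilon>\<^sup>2 * p / real n)) * \<pi>"
      using w0 p \<mu>_nonneg R_nonneg by (intro mult_mono mult_left_mono) auto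
    also have "\<dots> = \<epsilon>\<^sup>2 * p * ((w / real n) * \<pi>)" by simp
    also have "\<dots> \<le> \<epsilon>\<^sup>2 * p * (\<pi> * \<pi>)"
      using w_le_pagerank p w0 n_pos by (intro mult_left_mono mult_right_mono)
        (auto intro: order_trans[rotated] divide_nonneg_nonneg)
    finally have "\<kappa> * ((w * (R / real N)) * (w * \<mu>)) \<le> \<kappa> * (\<epsilon>\<^sup>2 * p * \<pi>\<^sup>2)"
      using \<kappa> by (intro mult_left_mono) (auto simp: power2_eq_square)
    moreover have "K * (real N * (R * \<mu>)) = \<kappa> * ((w * (R / real N)) * (w * \<mu>))"
      using False by (simp add: K_def power2_eq_square)
    ultimately show ?thesis by simp
  qed (use \<kappa> p in \<open>simp add: K_def\<close>)
  then show ?thesis by (simp add: sample_val_def)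
qed

end

section \<open>Analysis of the push phase\<close>

context single_node
begin

text \<open>The root of the initial value of \<open>L\<^sup>2 + 2 * n * in_load h\<close>, with
  \<open>L = 1\<close> for the target in the queue.\<close>

definition budget :: real where "budget = sqrt (1 + 2 * real n * in_load (visits g \<alpha> t))"

lemma budget_square: "budget\<^sup>2 = 1 + 2 * real n * in_load (visits g \<alpha> t)"
  and budget_nonneg: "0 \<le> budget"
  unfolding budget_def using in_load_nonneg[of "visits g \<alpha> t"] visits_nonneg by simp_all

text \<open>The last clause says that only pending nodes may exceed \<open>M\<close>; once the queue
  is exhausted, \<open>M\<close> bounds all scaled residues.\<close>

definition push_state ::
  "(nat \<Rightarrow> real) \<Rightarrow> nat \<Rightarrow> nat \<Rightarrow> (nat \<Rightarrow> nat) \<Rightarrow> real \<Rightarrow> real \<Rightarrow> bool" where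
  "push_state r L i q P M \<longleftrightarrow>
     (\<exists>h. potential g \<alpha> r h \<and> (\<forall>u\<in>verts g. 0 \<le> h u) \<and>
       (\<Sum>u\<in>verts g. h u) + P = (\<Sum>u\<in>verts g. visits g \<alpha> t u) \<and>
       (real L)\<^sup>2 + 2 * real n * in_load h \<le> budget\<^sup>2) \<and>
     (\<forall>u\<in>verts g. 0 \<le> r u) \<and> 0 \<le> P \<and> 0 \<le> M \<and> M \<le> budget \<and> i \<le> L \<and>
     (\<forall>j<L. q j \<in> verts g) \<and>
     (\<forall>v\<in>verts g. real n * r v \<le> M \<or> v \<in> q ` {i..<L})"

lemma push_state_init: "q 0 = t \<Longrightarrow> push_state (\<lambda>u. of_bool (u = t)) 1 0 q 0 0"
  unfolding push_state_def using potential_visits visits_nonneg t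
  by (auto simp: budget_square budget_nonneg intro!: exI[of _ "visits g \<alpha> t"])

lemma push_state_length: 
  assumes "push_state r L i q P M" shows "real L \<le> budget"
proof -
  obtain h where "\<forall>u\<in>verts g. 0 \<le> h u" and b: "(real L)\<^sup>2 + 2 * real n * in_load h \<le> budget\<^sup>2"
    using assms unfolding push_state_def by blast
  then have "0 \<le> 2 * real n * in_load h" using in_load_nonneg[of h] by simp
  then have "(real L)\<^sup>2 \<le> budget\<^sup>2" using b by linarith
  then show ?thesis using budget_nonneg by (rule power2_le_imp_le)
qed

text \<open>For \<open>x = n * r v\<close> the failed test gives
  \<open>x\<^sup>2 \<le> x * L + x * d\<close>. With
  \<open>2 * x * L \<le> x\<^sup>2 + L\<^sup>2\<close> and \<open>x * d \<le> n * in_load h\<close>,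
  the new maximum stays within the budget.\<close>

lemma push_state_skip:
  assumes S: "push_state r L i q P M" and i: "i < L"
    and le: "real n * r (q i) \<le> real (L + length (in_list g (q i)))"
  shows "push_state r L (Suc i) q P (max M (real n * r (q i)))"
proof -
  let ?v = "q i" and ?d = "real (length (in_list g (q i)))"
  obtain h where h: "potential g \<alpha> r h" "\<forall>u\<in>verts g. 0 \<le> h u"
    "(real L)\<^sup>2 + 2 * real n * in_load h \<le> budget\<^sup>2"
    using S unfolding push_state_def by blast
  have v: "?v \<in> verts g" and r0: "0 \<le> r ?v"
    using S i by (auto simp: push_state_def)
  define x where "x = real n * r ?v"
  have x0: "0 \<le> x" using r0 by (simp add: x_def)
  have "r ?v \<le> h ?v" using residue_le_potential[OF h(1) _ v] h(2) by blast
  then have "r ?v * ?d \<le> h ?v * ?d" by (intro mult_right_mono) auto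
  also have "\<dots> \<le> in_load h"
    unfolding in_load_def by (rule member_le_sum[OF v]) (use h in auto)
  finally have "real n * (r ?v * ?d) \<le> real n * in_load h" by (intro mult_left_mono) auto
  then have xd: "x * ?d \<le> real n * in_load h" by (simp add: x_def mult.assoc)
  have "x * x \<le> x * (real L + ?d)"
    using le x0 by (intro mult_left_mono) (auto simp: x_def)
  moreover have "2 * (x * real L) \<le> x\<^sup>2 + (real L)\<^sup>2"
    using sum_squares_bound[of x "real L"] by simp
  ultimately have "x\<^sup>2 \<le> budget\<^sup>2"
    using xd h(3) by (simp add: power2_eq_square distrib_left)
  then have "x \<le> budget" using budget_nonneg by (rule power2_le_imp_le)
  moreover have "real n * r u \<le> max M x \<or> u \<in> q ` {Suc i..<L}" if "u \<in> verts g" for u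
  proof (cases "u = ?v")
    case False
    have "real n * r u \<le> M \<or> u \<in> q ` {i..<L}" using S that by (auto simp: push_state_def)
    then show ?thesis
    proof
      assume "u \<in> q ` {i..<L}"
      then obtain j where "u = q j" "i \<le> j" "j < L" by auto
      then have "j \<in> {Suc i..<L}" using False by (cases "j = i") auto
      then show ?thesis using \<open>u = q j\<close> by blast
    qed auto
  qed (simp add: x_def)
  ultimately show ?thesis
    using S i unfolding push_state_def x_def[symmetric] by auto
qed

text \<open>\<open>L\<^sup>2\<close> grows by at most \<open>2 * d * (L + d)\<close>, which the test
  bounds by \<open>2 * d * n * r v\<close>, exactly the decrease of
  \<open>2 * n * in_load h\<close>.\<close>

lemma push_state_push:
  assumes S: "push_state r L i q P M" and i: "i < L" and v: "v = q i"
    and d: "d = length (in_list g v)"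
    and gt: "real (L + d) < real n * r v"
    and r': "\<And>u. r' u = (if u = v then 0 else r u) +
        (if u \<in> set (in_list g v) then (1 - \<alpha>) * r v / real (length (out_list g u)) else 0)"
    and q': "\<And>j. q' j = (if L \<le> j \<and> j < L + d then in_list g v ! (j - L) else q j)"
  shows "push_state r' (L + d) (Suc i) q' (P + r v) M"
proof -
  obtain h where h: "potential g \<alpha> r h" "\<forall>u\<in>verts g. 0 \<le> h u"
    "(\<Sum>u\<in>verts g. h u) + P = (\<Sum>u\<in>verts g. visits g \<alpha> t u)"
    "(real L)\<^sup>2 + 2 * real n * in_load h \<le> budget\<^sup>2"
    using S unfolding push_state_def by blast
  let ?h = "h(v := h v - r v)"
  have vV: "v \<in> verts g" and rv: "0 \<le> r v"
    using S i v by (auto simp: push_state_def)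
  have "r v \<le> h v" using residue_le_potential[OF h(1) _ vV] h(2) by blast
  then have h0: "\<forall>u\<in>verts g. 0 \<le> ?h u" using h by simp
  have sum: "(\<Sum>u\<in>verts g. ?h u * f u) = (\<Sum>u\<in>verts g. h u * f u) - r v * f v" for f :: "nat \<Rightarrow> real"
    using vV by (simp add: sum.remove[of _ v] left_diff_distrib)
  have load: "in_load ?h = in_load h - r v * real d"
    unfolding in_load_def d by (rule sum)
  have "(real (L + d))\<^sup>2 \<le> (real L)\<^sup>2 + 2 * (real d * real (L + d))"
    by (simp add: power2_eq_square algebra_simps)
  also have "\<dots> \<le> (real L)\<^sup>2 + 2 * (real d * (real n * r v))"
    using gt by (intro add_left_mono mult_left_mono) auto
  finally have bound: "(real (L + d))\<^sup>2 + 2 * real n * in_load ?h \<le> budget\<^sup>2"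
    using h(4) unfolding load by (simp add: algebra_simps)
  have mass: "(\<Sum>u\<in>verts g. ?h u) + (P + r v) = (\<Sum>u\<in>verts g. visits g \<alpha> t u)"
    using h(3) sum[of "\<lambda>_. 1"] by simp
  have r'0: "\<forall>u\<in>verts g. 0 \<le> r' u"
    using S rv \<alpha> by (auto simp: r' push_state_def intro!: add_nonneg_nonneg divide_nonneg_nonneg)
  have M0: "0 \<le> M" using S by (simp add: push_state_def)
  \<comment> \<open>Residues grow only at in-neighbours of \<open>v\<close>, and these have just
    been enqueued; with a self-loop, \<open>v\<close> is among them.\<close>
  have cover: "real n * r' u \<le> M \<or> u \<in> q' ` {Suc i..<L + d}" if u: "u \<in> verts g" for u
  proof (cases "u \<in> set (in_list g v)")
    case True
    then obtain k where "k < d" "u = in_list g v ! k" by (auto simp: in_set_conv_nth d)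
    then have "u = q' (L + k)" "L + k \<in> {Suc i..<L + d}" using i by (auto simp: q')
    then show ?thesis by blast
  next
    case False
    show ?thesis
    proof (cases "u = v")
      case True
      then show ?thesis using False M0 by (simp add: r')
    next
      case ne: False
      have "real n * r u \<le> M \<or> u \<in> q ` {i..<L}" using S u by (auto simp: push_state_def)
      then show ?thesis
      proof
        assume "u \<in> q ` {i..<L}"
        then obtain j where j: "u = q j" "i \<le> j" "j < L" by auto
        then have "j \<in> {Suc i..<L + d}" "u = q' j" using ne v by (cases "j = i"; auto simp: q')+
        then show ?thesis by blast
      qed (use False ne in \<open>simp add: r'\<close>)
    qed
  qed
  have qV: "\<forall>j<L + d. q' j \<in> verts g"
    using S in_in_verts[OF nth_mem] by (auto simp: q' push_state_def d)
  show ?thesis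
    unfolding push_state_def
    using potential_push[OF h(1) r'] h0 mass bound r'0 M0 cover qV S rv i
    by (auto simp: push_state_def intro!: exI[of _ ?h])
qed

section \<open>Amortised cost of the push loop\<close>

definition ready :: "mem \<Rightarrow> bool" where
  "ready s \<longleftrightarrow> input_intact s \<and> imem s 1 7 = 0 \<and> rmem s 1 3 = 0"

definition sample_bound :: real where
  "sample_bound = c * (sample_cost * (budget / (\<alpha> * (\<epsilon> * \<epsilon> * p)) + 1) + 4) + \<kappa> * (\<epsilon>\<^sup>2 * p * \<pi>\<^sup>2)"

text \<open>Head and length of the queue are both bounded by the budget. A popped node is charged 12
  steps, which is ample, an appended entry 7 for its relaxation and guard, and the exit guard
  1.\<close>

definition push_val :: "nat \<Rightarrow> nat \<Rightarrow> real" where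
  "push_val L i = c * (12 * (budget - real i) + 7 * (budget - real L) + 1) + sample_bound"

definition push_inv :: "mem \<Rightarrow> ennreal" where
  "push_inv s = (if ready s \<and> push_state (rmem s 2) (imem s 1 0) (imem s 1 1) (imem s 2) (rmem s 1 0) (rmem s 1 1)
     then ennreal (push_val (imem s 1 0) (imem s 1 1)) else \<top>)"

lemma sample_bound_nonneg: "0 \<le> sample_bound"
  unfolding sample_bound_def using c \<kappa> sample_cost_nonneg budget_nonneg \<alpha> \<epsilon> p
  by (intro add_nonneg_nonneg mult_nonneg_nonneg divide_nonneg_nonneg) auto

lemma push_val_nonneg:
  assumes "push_state r L i q P M" shows "0 \<le> push_val L i"
proof -
  have "real L \<le> budget" "real i \<le> budget"
    using push_state_length[OF assms] assms by (auto simp: push_state_def)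
  then show ?thesis
    unfolding push_val_def using c sample_bound_nonneg
    by (intro add_nonneg_nonneg mult_nonneg_nonneg) auto
qed

text \<open>With no pending entries the invariant provides all assumptions of \<open>pushed\<close>.
  The sample size is largest for \<open>M = budget\<close>, and rounding up adds at most 1.\<close>

lemma sampling_bound:
  assumes s: "ready s" and S: "push_state (rmem s 2) (imem s 1 0) (imem s 1 1) (imem s 2) (rmem s 1 0) (rmem s 1 1)"
    and i: "\<not> imem s 1 1 < imem s 1 0"
  shows "wp g c post (While sample_guard sample_body # output_code, s) \<le> ennreal sample_bound"
proof -
  define P M where "P = rmem s 1 0" and "M = rmem s 1 1"
  then have PM: "rmem s 1 0 = P" "rmem s 1 1 = M" by simp_all
  obtain h where h: "potential g \<alpha> (rmem s 2) h" "\<forall>u\<in>verts g. 0 \<le> h u"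
    "(\<Sum>u\<in>verts g. h u) + rmem s 1 0 = (\<Sum>u\<in>verts g. visits g \<alpha> t u)"
    using S unfolding push_state_def by blast
  interpret pushed g \<alpha> t \<epsilon> p c \<kappa> "rmem s 2" h P M
    using S i h unfolding PM by unfold_locales (auto simp: push_state_def)
  have "0 < \<alpha> * (\<epsilon> * \<epsilon> * p)" using \<alpha> \<epsilon> p by simp
  moreover have "M \<le> budget" using S by (simp add: push_state_def M_def)
  ultimately have "M / (\<alpha> * (\<epsilon> * \<epsilon> * p)) \<le> budget / (\<alpha> * (\<epsilon> * \<epsilon> * p))"
    by (intro divide_right_mono) auto
  moreover have "real (num_samples M) \<le> M / (\<alpha> * (\<epsilon> * \<epsilon> * p)) + 1"
    unfolding num_samples_def
    using of_int_ceiling_le_add_one[of "M / (\<alpha> * (\<epsilon> * \<epsilon> * p))"] M_nonneg \<open>0 < \<alpha> * (\<epsilon> * \<epsilon> * p)\<close>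
    by (simp add: of_nat_nat)
  ultimately have "c * (sample_cost * real (num_samples M) + 4)
      \<le> c * (sample_cost * (budget / (\<alpha> * (\<epsilon> * \<epsilon> * p)) + 1) + 4)"
    using c sample_cost_nonneg by (intro mult_left_mono add_right_mono) auto
  then have *: "sample_val 0 0 \<le> sample_bound"
    using sample_val_start_le unfolding sample_bound_def by linarith
  have "wp g c post (While sample_guard sample_body # output_code, s) \<le> sample_inv s"
    by (rule sampling_le)
  also have "\<dots> = ennreal (sample_val 0 0)"
    using s PM by (simp add: sample_inv_def intact_def ready_def)
  also have "\<dots> \<le> ennreal sample_bound" using * by (rule ennreal_leI)
  finally show ?thesis .
qed

lemma relax_loop_le:
  assumes s0: "ready s0" and S: "push_state r L i q P M" and i: "i < L" and v: "v = q i"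
    and d: "d = length (in_list g v)" and gt: "real (L + d) < real n * r v"
    and s: "imem s0 1 0 = L" "imem s0 1 1 = Suc i" "imem s0 1 2 = v" "imem s0 1 3 = d" "imem s0 1 4 = 0"
      "imem s0 2 = q" "rmem s0 1 0 = P + r v" "rmem s0 1 1 = M" "rmem s0 1 2 = r v" "rmem s0 2 = r(v := 0)"
  shows "wp g c push_inv ([While relax_guard relax_body], s0)
     \<le> ennreal (c * (7 * real d + 1) + push_val (L + d) (Suc i))"
proof -
  define B where "B = push_val (L + d) (Suc i)"
  \<comment> \<open>\<open>qq j\<close> and \<open>rr j\<close> are queue and residue after
    \<open>j\<close> in-neighbours; they lead from \<open>q\<close> and \<open>r(v := 0)\<close> to
    the state of \<open>push_state_push\<close>.\<close>
  define qq where "qq j = (\<lambda>k. if L \<le> k \<and> k < L + j then in_list g v ! (k - L) else q k)" for j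
  define rr where "rr j = (\<lambda>u. (if u = v then 0 else r u) + (if u \<in> set (take j (in_list g v))
     then (1 - \<alpha>) * r v / real (length (out_list g u)) else 0))" for j
  define J where "J s \<longleftrightarrow> ready s \<and> imem s 1 4 \<le> d \<and> imem s 1 0 = L + imem s 1 4 \<and>
     imem s 1 1 = Suc i \<and> imem s 1 2 = v \<and> imem s 1 3 = d \<and> imem s 2 = qq (imem s 1 4) \<and>
     rmem s 1 0 = P + r v \<and> rmem s 1 1 = M \<and> rmem s 1 2 = r v \<and> rmem s 2 = rr (imem s 1 4)" for s
  define I where "I s = (if J s then ennreal (c * (7 * (real d - real (imem s 1 4)) + 1) + B) else \<top>)" for s
  have S': "push_state (rr d) (L + d) (Suc i) (qq d) (P + r v) M"
    by (rule push_state_push[OF S i v d gt]) (auto simp: rr_def qq_def d)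
  then have B0: "0 \<le> B" unfolding B_def by (rule push_val_nonneg)
  have qq_Suc: "(qq j)(L + j := in_list g v ! j) = qq (Suc j)" for j
    by (auto simp: qq_def fun_eq_iff)
  \<comment> \<open>Since in-lists are distinct, the node relaxed now has not received its share
    before.\<close>
  have rr_Suc: "(rr j)(x := rr j x + (1 - \<alpha>) * r v / real (length (out_list g x))) = rr (Suc j)"
    if "j < d" "x = in_list g v ! j" for j x
  proof -
    have "x \<notin> set (take j (in_list g v))"
      using that d distinct_in[of v] by (auto simp: in_set_conv_nth nth_eq_iff_index_eq)
    moreover have "set (take (Suc j) (in_list g v)) = insert x (set (take j (in_list g v)))"
      using that d by (simp add: take_Suc_conv_app_nth)
    ultimately show ?thesis by (auto simp: rr_def fun_eq_iff)
  qed
  have "wp g c push_inv ([While relax_guard relax_body], s0) \<le> I s0"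
  proof (rule wp_While)
    fix s assume b: "bval s relax_guard"
    show "ennreal c + wp g c I (relax_body, s) \<le> I s"
    proof (cases "J s")
      case True
      define j where "j = imem s 1 4"
      have j: "j < d" using b True by (simp add: relax_guard_def J_def j_def)
      define s' where "s' = iwrite 1 4 (Suc j) (iwrite 1 0 (Suc (L + j)) (iwrite 2 (L + j) (in_list g v ! j)
        (rwrite 2 (in_list g v ! j) (rr j (in_list g v ! j) + (1 - \<alpha>) * r v / real (length (out_list g (in_list g v ! j))))
        (iwrite 1 6 (length (out_list g (in_list g v ! j))) (iwrite 1 5 (in_list g v ! j) s)))))"
      have "J s'"
        using True j unfolding J_def s'_def
        by (simp add: iwrite_def rwrite_def ready_def input_intact_def j_def[simplified, symmetric] qq_Suc rr_Suc)
      moreover have "imem s' 1 4 = Suc j" by (simp add: s'_def iwrite_def)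
      ultimately have I': "I s' = ennreal (c * (7 * (real d - real (Suc j)) + 1) + B)"
        by (simp add: I_def)
      have "wp g c I (relax_body, s) = ennreal c + (ennreal c + (ennreal c + (ennreal c + (ennreal c + (ennreal c + I s')))))"
        using True j d
        by (simp add: relax_body_def wp_instr s'_def iwrite_def rwrite_def nth_or_0_def J_def ready_def
          input_intact_def j_def[simplified, symmetric])
      then have "ennreal c + wp g c I (relax_body, s)
          = ennreal (7 * c + (c * (7 * (real d - real (Suc j)) + 1) + B))"
        using c B0 j unfolding I'
        by (simp add: ennreal_plus[symmetric] del: ennreal_plus)
      then show ?thesis using True
        by (simp add: I_def j_def algebra_simps)
    qed (simp add: I_def)
  next
    fix s assume b: "\<not> bval s relax_guard"
    show "ennreal c + wp g c push_inv ([], s) \<le> I s"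
    proof (cases "J s")
      case True
      then have "imem s 1 4 = d" using b by (simp add: relax_guard_def J_def)
      then have "push_inv s = ennreal B" using True S' by (simp add: push_inv_def J_def B_def)
      then show ?thesis using True \<open>imem s 1 4 = d\<close> c B0 by (simp add: I_def)
    qed (simp add: I_def)
  qed
  also have "J s0"
    using s0 s by (auto simp: J_def qq_def rr_def fun_eq_iff)
  then have "I s0 = ennreal (c * (7 * real d + 1) + B)" using s by (simp add: I_def)
  finally show ?thesis by (simp add: B_def)
qed

lemma push_body_le:
  assumes s: "ready s" and S: "push_state (rmem s 2) (imem s 1 0) (imem s 1 1) (imem s 2) (rmem s 1 0) (rmem s 1 1)"
    and i: "imem s 1 1 < imem s 1 0"
  shows "ennreal c + wp g c push_inv (push_body, s) \<le> push_inv s"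
proof -
  define r L i q P M where "r = rmem s 2" and "L = imem s 1 0" and "i = imem s 1 1" and "q = imem s 2"
    and "P = rmem s 1 0" and "M = rmem s 1 1"
  note defs = r_def L_def i_def q_def P_def M_def
  define v d where "v = q i" and "d = length (in_list g v)"
  have S: "push_state r L i q P M" and iL: "i < L" using S i by (simp_all add: defs)
  have n: "imem s 0 (Suc 0) = n" using s by (simp add: ready_def input_intact_def)
  have pi: "push_inv s = ennreal (push_val L i)"
    using s S by (simp add: push_inv_def defs)
  show ?thesis
  proof (cases "real (L + d) < real n * r v")
    case True
    define s' where "s' = iwrite 1 4 0 (rwrite 1 0 (P + r v) (rwrite 2 v 0 (rwrite 1 2 (r v)
      (iwrite 1 3 d (iwrite 1 1 (Suc i) (iwrite 1 2 v s))))))"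
    have "wp g c push_inv (push_body, s) = ennreal (8 * c) + wp g c push_inv ([While relax_guard relax_body], s')"
      using True c n
      by (simp add: push_body_def wp_instr s'_def iwrite_def rwrite_def v_def d_def defs
        add.assoc[symmetric] ennreal_plus[symmetric] del: ennreal_plus)
    moreover have "wp g c push_inv ([While relax_guard relax_body], s')
        \<le> ennreal (c * (7 * real d + 1) + push_val (L + d) (Suc i))"
      by (rule relax_loop_le[OF _ S iL v_def d_def True])
        (use s in \<open>simp_all add: s'_def iwrite_def rwrite_def defs ready_def input_intact_def\<close>)
    moreover have "0 \<le> push_val (L + d) (Suc i)"
      by (rule push_val_nonneg, rule push_state_push[OF S iL v_def d_def True refl refl])
    ultimately have "wp g c push_inv (push_body, s) \<le> ennreal (8 * c + (c * (7 * real d + 1) + push_val (L + d) (Suc i)))"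
      using c by (auto intro!: ennreal_add_le)
    then have "ennreal c + wp g c push_inv (push_body, s) \<le> ennreal (push_val L i)"
    proof (rule ennreal_add_le)
      show "0 \<le> 8 * c + (c * (7 * real d + 1) + push_val (L + d) (Suc i))"
        using c \<open>0 \<le> push_val (L + d) (Suc i)\<close> by (intro add_nonneg_nonneg mult_nonneg_nonneg) auto
    qed (use c in \<open>auto simp: push_val_def algebra_simps\<close>)
    then show ?thesis by (simp add: pi)
  next
    case False
    have S': "push_state r L (Suc i) q P (max M (real n * r v))"
      using push_state_skip[OF S iL] False by (simp add: v_def d_def)
    have "wp g c push_inv (push_body, s) \<le> ennreal (6 * c + push_val L (Suc i))"
      using False c n s S' push_val_nonneg[OF S']
      by (auto simp: push_body_def wp_instr iwrite_def rwrite_def v_def d_def push_inv_def ready_def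
         input_intact_def defs max_def not_less ennreal_plus[symmetric] split: if_splits simp del: ennreal_plus
         intro!: ennreal_leI)
    then have "ennreal c + wp g c push_inv (push_body, s) \<le> ennreal (push_val L i)"
      by (rule ennreal_add_le)
        (use c push_val_nonneg[OF S'] in \<open>auto simp: push_val_def algebra_simps\<close>)
    then show ?thesis by (simp add: pi)
  qed
qed

lemma push_loop_le:
  "wp g c post ([While push_guard push_body, While sample_guard sample_body] @ output_code, s) \<le> push_inv s"
  unfolding append_Cons append_Nil
proof (rule wp_While)
  fix s assume "bval s push_guard"
  then show "ennreal c + wp g c push_inv (push_body, s) \<le> push_inv s"
    using push_body_le[of s] by (cases "push_inv s = \<top>") (auto simp: push_guard_def push_inv_def)
next
  fix s assume b: "\<not> bval s push_guard"
  show "ennreal c + wp g c post (While sample_guard sample_body # output_code, s) \<le> push_inv s"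
  proof (cases "push_inv s = \<top>")
    case False
    then have s: "ready s" and S: "push_state (rmem s 2) (imem s 1 0) (imem s 1 1) (imem s 2) (rmem s 1 0) (rmem s 1 1)"
      by (auto simp: push_inv_def split: if_splits)
    have L: "real (imem s 1 0) \<le> budget" "real (imem s 1 1) \<le> budget"
      using push_state_length[OF S] S by (auto simp: push_state_def)
    have "ennreal c + wp g c post (While sample_guard sample_body # output_code, s)
       \<le> ennreal (push_val (imem s 1 0) (imem s 1 1))"
    proof (rule ennreal_add_le[OF sampling_bound[OF s S]])
      have "c * 1 \<le> c * (12 * (budget - real (imem s 1 1)) + 7 * (budget - real (imem s 1 0)) + 1)"
        using c L by (intro mult_left_mono) auto
      then show "c + sample_bound \<le> push_val (imem s 1 0) (imem s 1 1)" by (simp add: push_val_def)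
    qed (use b c sample_bound_nonneg in \<open>auto simp: push_guard_def\<close>)
    then show ?thesis using s S by (simp add: push_inv_def)
  qed simp
qed

text \<open>In \<open>19 = 12 + 7\<close>, every unit of budget pays for one popped and one appended
  entry.\<close>

definition time_bound :: real where
  "time_bound = 8 + sample_cost + (19 + sample_cost / (\<alpha> * (\<epsilon> * \<epsilon> * p))) * budget"

lemma wp_pagerank_program:
  "wp g c post (pagerank_program, init_mem \<alpha> \<epsilon> p g t)
    \<le> ennreal (c * time_bound + \<kappa> * (\<epsilon>\<^sup>2 * p * \<pi>\<^sup>2))"
proof -
  define s where "s = rwrite 2 t 1 (iwrite 1 0 1 (iwrite 2 0 t (init_mem \<alpha> \<epsilon> p g t)))"
  have S: "push_state (rmem s 2) (imem s 1 0) (imem s 1 1) (imem s 2) (rmem s 1 0) (rmem s 1 1)"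
  proof -
    have "rmem s 2 = (\<lambda>u. of_bool (u = t))"
      by (auto simp: s_def init_mem_def iwrite_def rwrite_def)
    then show ?thesis using push_state_init[of "imem s 2"]
      by (simp add: s_def init_mem_def iwrite_def rwrite_def)
  qed
  have "ready s"
    by (simp add: s_def init_mem_def iwrite_def rwrite_def ready_def input_intact_def nth_or_0_def)
  then have "push_inv s = ennreal (push_val 1 0)"
    using S by (simp add: push_inv_def s_def init_mem_def iwrite_def rwrite_def)
  then have le: "wp g c post ([While push_guard push_body, While sample_guard sample_body] @ output_code, s)
      \<le> ennreal (push_val 1 0)" using push_loop_le[of s] by simp
  have pv: "0 \<le> push_val 1 0"
    using push_val_nonneg[OF S] by (simp add: s_def init_mem_def iwrite_def rwrite_def)
  have "wp g c post (pagerank_program, init_mem \<alpha> \<epsilon> p g t) = ennreal (3 * c) +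
     wp g c post ([While push_guard push_body, While sample_guard sample_body] @ output_code, s)"
    using c by (simp add: pagerank_program_def wp_instr s_def init_mem_def iwrite_def rwrite_def nth_or_0_def
      add.assoc[symmetric] ennreal_plus[symmetric] del: ennreal_plus)
  also have "\<dots> \<le> ennreal (c * time_bound + \<kappa> * (\<epsilon>\<^sup>2 * p * \<pi>\<^sup>2))"
    by (rule ennreal_add_le[OF le pv])
      (use c in \<open>auto simp: push_val_def sample_bound_def time_bound_def algebra_simps\<close>)
  finally show ?thesis .
qed

text \<open>A tangent bound for the root, linear in the load and hence easy to average over targets;
  \<open>1 \<le> m\<close> absorbs the 1 under the root.\<close>

lemma budget_le:
  assumes m: "1 \<le> m"
  shows "budget \<le> sqrt m + real n * in_load (visits g \<alpha> t) / sqrt m"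
proof -
  define D where "D = real n * in_load (visits g \<alpha> t)"
  have D: "0 \<le> D" unfolding D_def using in_load_nonneg[of "visits g \<alpha> t"] visits_nonneg by simp
  have "(sqrt m + D / sqrt m)\<^sup>2 = m + 2 * D + (D / sqrt m)\<^sup>2"
    using m by (simp add: power2_sum)
  then have "1 + 2 * D \<le> (sqrt m + D / sqrt m)\<^sup>2"
    using m zero_le_power2[of "D / sqrt m"] by linarith
  then have "sqrt (1 + 2 * D) \<le> sqrt m + D / sqrt m"
    using m D by (intro real_le_lsqrt) auto
  then show ?thesis by (simp add: budget_def D_def mult.assoc)
qed

end

section \<open>Guarantees of the program and the average over targets\<close>

context discounted_graph
begin

lemma expected_time_le:
  assumes "t \<in> verts g" "0 < \<epsilon>" "0 < p"
  shows "expected_time \<alpha> \<epsilon> p pagerank_program g t \<le> ennreal (single_node.time_bound g \<alpha> t \<epsilon> p)"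
proof -
  interpret single_node g \<alpha> t \<epsilon> p 1 0
    using assms by unfold_locales auto
  have "post = (\<lambda>_. 0)" by (simp add: post_def fun_eq_iff)
  then show ?thesis
    using expected_time_le_wp[of \<alpha> \<epsilon> p pagerank_program g t] wp_pagerank_program by simp
qed

text \<open>Chebyshev's inequality: for this \<open>\<kappa>\<close>, \<open>post\<close> is at
  least \<open>1\<close> on every failing output, so its expectation bounds their probability.
  Almost sure halting comes from \<open>expected_time_le\<close>.\<close>

lemma failure_prob_le:
  assumes "t \<in> verts g" "0 < \<epsilon>" "0 < p"
  shows "failure_prob \<alpha> \<epsilon> p pagerank_program g t \<le> p"
proof -
  let ?\<pi> = "pagerank g \<alpha> t"
  interpret single_node g \<alpha> t \<epsilon> p 0 "1 / (\<epsilon> * ?\<pi>)\<^sup>2"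
    using assms by unfold_locales auto
  have "0 < w / real n" using stop_prob_bounds n_pos by simp
  then have pos: "0 < \<epsilon> * ?\<pi>" using w_le_pagerank \<epsilon> by simp
  have "indicator {s. \<bar>rmem s 0 0 - ?\<pi>\<bar> \<ge> \<epsilon> * ?\<pi>} s \<le> post s" for s
  proof (cases "\<epsilon> * ?\<pi> \<le> \<bar>rmem s 0 0 - ?\<pi>\<bar>")
    case True
    then have "(\<epsilon> * ?\<pi>)\<^sup>2 \<le> (rmem s 0 0 - ?\<pi>)\<^sup>2" using pos by (simp add: abs_le_square_iff[symmetric])
    then have "1 \<le> 1 / (\<epsilon> * ?\<pi>)\<^sup>2 * (rmem s 0 0 - ?\<pi>)\<^sup>2"
      using zero_less_power[OF pos, of 2] by (simp add: le_divide_eq)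
    then have "ennreal 1 \<le> post s" unfolding post_def by (rule ennreal_leI)
    then show ?thesis by (simp add: indicator_def)
  qed simp
  then have "wp g 0 (indicator {s. \<bar>rmem s 0 0 - ?\<pi>\<bar> \<ge> \<epsilon> * ?\<pi>}) (pagerank_program, init_mem \<alpha> \<epsilon> p g t)
     \<le> wp g 0 post (pagerank_program, init_mem \<alpha> \<epsilon> p g t)"
    by (rule wp_mono)
  also have "\<dots> \<le> ennreal (1 / (\<epsilon> * ?\<pi>)\<^sup>2 * (\<epsilon>\<^sup>2 * p * ?\<pi>\<^sup>2))"
    using wp_pagerank_program by simp
  also have "1 / (\<epsilon> * ?\<pi>)\<^sup>2 * (\<epsilon>\<^sup>2 * p * ?\<pi>\<^sup>2) = p"
    using pos by (auto simp: power_mult_distrib)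
  finally show ?thesis
    using expected_time_le[OF assms] p
    by (intro failure_prob_le_wp) (auto intro: le_less_trans)
qed

text \<open>The bound for one target is linear in \<open>D t\<close>, so summing it reduces to the
  total load; the factor \<open>n\<close> cancels against the average.\<close>

lemma average_time_le:
  assumes "0 < \<epsilon>" "0 < p" and m: "1 \<le> card (edges g)"
  defines "C\<^sub>0 \<equiv> 13 + 7 / \<alpha>" and "C\<^sub>1 \<equiv> 19 + (5 + 7 / \<alpha>) / (\<alpha> * (\<epsilon> * \<epsilon> * p))"
  shows "(\<Sum>t\<in>verts g. expected_time \<alpha> \<epsilon> p pagerank_program g t) / of_nat (card (verts g))
    \<le> ennreal ((C\<^sub>0 + C\<^sub>1 + C\<^sub>1 / \<alpha>) * sqrt (card (edges g)))"
proof -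
  define n where "n = card (verts g)"
  define q where "q = sqrt (card (edges g))"
  define D where "D t = in_load (visits g \<alpha> t)" for t
  define B where "B t = C\<^sub>0 + C\<^sub>1 * (q + n * D t / q)" for t
  have n: "0 < real n" using card_verts_pos by (simp add: n_def)
  have q: "1 \<le> q" "q * q = card (edges g)" using m by (simp_all add: q_def)
  have C: "0 \<le> C\<^sub>0" "0 \<le> C\<^sub>1" using \<alpha> assms by (simp_all add: C\<^sub>0_def C\<^sub>1_def)
  have D: "0 \<le> D t" for t
    unfolding D_def by (intro in_load_nonneg visits_nonneg)
  have B: "0 \<le> B t" for t unfolding B_def using C q n D[of t] by simp
  have "expected_time \<alpha> \<epsilon> p pagerank_program g t \<le> ennreal (B t)" if "t \<in> verts g" for t
  proof -
    interpret single_node g \<alpha> t \<epsilon> p 1 0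
      using assms that by unfold_locales auto
    have "budget \<le> q + n * D t / q"
      using budget_le[of "card (edges g)"] m by (simp add: q_def D_def n_def)
    then have "C\<^sub>1 * budget \<le> C\<^sub>1 * (q + n * D t / q)" by (intro mult_left_mono C)
    then have "time_bound \<le> B t"
      by (simp add: time_bound_def sample_cost_def B_def C\<^sub>0_def C\<^sub>1_def)
    then show ?thesis
      using expected_time_le[OF that assms(1,2)] by (meson ennreal_leI order_trans)
  qed
  then have "(\<Sum>t\<in>verts g. expected_time \<alpha> \<epsilon> p pagerank_program g t) / of_nat n
      \<le> (\<Sum>t\<in>verts g. ennreal (B t)) / of_nat n"
    by (intro divide_right_mono_ennreal sum_mono)
  also have "\<dots> = ennreal ((\<Sum>t\<in>verts g. B t) / n)"
    using B n by (simp add: sum_nonneg divide_ennreal ennreal_of_nat_eq_real_of_nat)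
  also have "(\<Sum>t\<in>verts g. B t) / n = C\<^sub>0 + C\<^sub>1 * (q + (\<Sum>t\<in>verts g. D t) / q)"
  proof -
    have "(\<Sum>t\<in>verts g. B t) = n * (C\<^sub>0 + C\<^sub>1 * q) + (\<Sum>t\<in>verts g. n * (C\<^sub>1 / q) * D t)"
      by (simp add: B_def n_def sum.distrib algebra_simps)
    also have "(\<Sum>t\<in>verts g. n * (C\<^sub>1 / q) * D t) = n * (C\<^sub>1 / q) * (\<Sum>t\<in>verts g. D t)"
      by (simp only: sum_distrib_left)
    finally show ?thesis using n by (simp add: field_simps)
  qed
  \<comment> \<open>\<open>1 \<le> q\<close> absorbs the constant term, and dividing the number of
    edges by \<open>q\<close> leaves its root \<open>q\<close>.\<close>
  also have "\<dots> \<le> C\<^sub>0 * q + C\<^sub>1 * (q + q / \<alpha>)"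
  proof (intro add_mono mult_left_mono C add_left_mono)
    have "(\<Sum>t\<in>verts g. D t) / q \<le> (q * q / \<alpha>) / q"
      unfolding D_def q(2) using sum_in_load_visits_le q by (intro divide_right_mono) auto
    then show "(\<Sum>t\<in>verts g. D t) / q \<le> q / \<alpha>" using q(1) by simp
  qed (use C q mult_left_mono[of 1 q C\<^sub>0] in auto)
  also have "\<dots> = (C\<^sub>0 + C\<^sub>1 + C\<^sub>1 / \<alpha>) * q" by (simp add: algebra_simps)
  finally show ?thesis by (simp add: n_def q_def ennreal_leI)
qed

end

theorem theorem6p3:
  fixes \<alpha> \<epsilon> p\<^sub>f :: real
  assumes "0 < \<alpha>" "\<alpha> < 1" and "0 < \<epsilon>" "\<epsilon> < 1" and "0 < p\<^sub>f" "p\<^sub>f < 1"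
  shows "\<exists>P. solves_single_node \<alpha> \<epsilon> p\<^sub>f P \<and>
             soft_O (average_case_time \<alpha> \<epsilon> p\<^sub>f P) (\<lambda>n m. sqrt (real m))"
proof (intro exI conjI)
  have loc: "discounted_graph g \<alpha>" if "wf_graph g" for g
    using that assms by unfold_locales
  show "solves_single_node \<alpha> \<epsilon> p\<^sub>f pagerank_program"
    unfolding solves_single_node_def
    using discounted_graph.failure_prob_le[OF loc] assms by blast
  let ?C\<^sub>0 = "13 + 7 / \<alpha>" and ?C\<^sub>1 = "19 + (5 + 7 / \<alpha>) / (\<alpha> * (\<epsilon> * \<epsilon> * p\<^sub>f))"
  \<comment> \<open>The exponent \<open>0\<close> is the witness: the bound is of order
    \<open>sqrt m\<close> without a logarithmic factor.\<close>
  have "average_case_time \<alpha> \<epsilon> p\<^sub>f pagerank_program n m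
      \<le> ennreal ((?C\<^sub>0 + ?C\<^sub>1 + ?C\<^sub>1 / \<alpha>) * sqrt (real m) * (1 + ln (real n)) ^ 0)" if "m \<ge> 1" for n m
    unfolding average_case_time_def
  proof (rule SUP_least)
    fix g assume "g \<in> graphs n m"
    then have "wf_graph g" "card (verts g) = n" "card (edges g) = m" by (auto simp: graphs_def)
    then show "(\<Sum>t\<in>verts g. expected_time \<alpha> \<epsilon> p\<^sub>f pagerank_program g t) / of_nat n
        \<le> ennreal ((?C\<^sub>0 + ?C\<^sub>1 + ?C\<^sub>1 / \<alpha>) * sqrt (real m) * (1 + ln (real n)) ^ 0)"
      using discounted_graph.average_time_le[OF loc assms(3,5), of g] that by simp
  qed
  then show "soft_O (average_case_time \<alpha> \<epsilon> p\<^sub>f pagerank_program) (\<lambda>n m. sqrt (real m))"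
    unfolding soft_O_def by blast
qed

end
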